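(* For every $n\ge 1$ and every $(a_1,\ldots,a_n)\in\mathbb{N}^n$, the order complex $\Delta(P(a_1,\ldots,a_n))$ is (non-pure) shellable. In particular, $\Delta(P(a_1,\ldots,a_n))$ is homotopy equivalent to a wedge of spheres, and its reduced simplicial homology groups $\widetilde{H}_\bullet(\Delta(P(a_1,\ldots,a_n));\mathbb{Z})$ are torsion-free.
   Context: Here $\mathbb{N}=\{0,1,2,\ldots\}$. For $(a_1,\ldots,a_n),(b_1,\ldots,b_n)\in\mathbb{N}^n$, say that $(a_1,\ldots,a_n)$ properly divides $(b_1,\ldots,b_n)$ if for every $1\le i\le n$ either $a_i=b_i=0$ or $a_i<b_i$. Write $(a_1,\ldots,a_n)\le(b_1,\ldots,b_n)$ if the two are equal or the first properly divides the second; this is a partial order. Let $P(a_1,\ldots,a_n)=\{(b_1,\ldots,b_n)\in\mathbb{N}^n : (b_1,\ldots,b_n)\le(a_1,\ldots,a_n)\}$, ordered by $\le$. It has unique minimal element $\widehat{0}=(0,\ldots,0)$ and unique maximal element $\widehat{1}=(a_1,\ldots,a_n)$. For a finite poset $P$ with unique minimal element $\widehat 0$ and unique maximal element $\widehat 1$, the order complex $\Delta(P)$ is the simplicial complex of all chains (including the empty chain) in $P\setminus\{\widehat{0},\widehat{1}\}$. A finite simplicial complex, not necessarily pure, is shellable if its facets can be ordered $F_1,\ldots,F_m$ so that for every $2\le j\le m$ the complex $\big(\bigcup_{i<j} 2^{F_i}\big)\cap 2^{F_j}$ is pure of dimension $\dim F_j-1$. A wedge of spheres may involve spheres of different dimensions;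 the empty wedge is a point, and the complex $\{\emptyset\}$ is regarded as a sphere of dimension $-1$. *)

theory Defs
  imports "HOL-Analysis.Analysis" "HOL-Algebra.Coset"
begin

definition properly_divides :: "nat list \<Rightarrow> nat list \<Rightarrow> bool" where
  "properly_divides a b \<longleftrightarrow> list_all2 (\<lambda>x y. (x = 0 \<and> y = 0) \<or> x < y) a b"

definition pd_le :: "nat list \<Rightarrow> nat list \<Rightarrow> bool" where
  "pd_le a b \<longleftrightarrow> a = b \<or> properly_divides a b"

definition pd_poset :: "nat list \<Rightarrow> nat list set" where
  "pd_poset a = {b. pd_le b a}"

lemma pd_le_refl: "pd_le a a"
  by (simp add: pd_le_def)

lemma properly_divides_nth:
  "properly_divides a b \<longleftrightarrow> length a = length b \<and>
     (\<forall>i<length a. (a ! i = 0 \<and> b ! i = 0) \<or> a ! i < b ! i)"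
  by (simp add: properly_divides_def list_all2_conv_all_nth)

lemma properly_divides_trans:
  assumes "properly_divides a b" "properly_divides b c"
  shows "properly_divides a c"
  unfolding properly_divides_nth
proof (intro conjI allI impI)
  fix i assume "i < length a"
  then show "(a ! i = 0 \<and> c ! i = 0) \<or> a ! i < c ! i"
    using assms[unfolded properly_divides_nth, THEN conjunct2, rule_format, of i] assms(1)
    by (auto simp: properly_divides_nth)
qed (use assms in \<open>simp add: properly_divides_nth\<close>)

lemma pd_le_trans: "pd_le a b \<Longrightarrow> pd_le b c \<Longrightarrow> pd_le a c"
  unfolding pd_le_def using properly_divides_trans by blast

lemma pd_le_antisym:
  assumes "pd_le a b" "pd_le b a"
  shows "a = b"
proof (rule ccontr)
  assume "a \<noteq> b"
  with assms have ab: "properly_divides a b" and ba: "properly_divides b a"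
    by (auto simp: pd_le_def)
  have "a = b"
  proof (rule nth_equalityI)
    show "length a = length b" using ab by (simp add: properly_divides_nth)
    fix i assume i: "i < length a"
    then have "i < length b" using ab by (simp add: properly_divides_nth)
    with i ab ba have "(a ! i = 0 \<and> b ! i = 0) \<or> a ! i < b ! i" "(b ! i = 0 \<and> a ! i = 0) \<or> b ! i < a ! i"
      unfolding properly_divides_nth by blast+
    then show "a ! i = b ! i" by linarith
  qed
  with \<open>a \<noteq> b\<close> show False by simp
qed

lemma length_pd_poset: "b \<in> pd_poset a \<Longrightarrow> length b = length a"
  by (auto simp: pd_poset_def pd_le_def properly_divides_def dest: list_all2_lengthD)

lemma pd_poset_least: "b \<in> pd_poset a \<Longrightarrow> pd_le (replicate (length a) 0) b"
  by (drule length_pd_poset)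
    (auto simp: pd_le_def properly_divides_nth)

lemma zero_in_pd_poset: "replicate (length a) 0 \<in> pd_poset a"
  using pd_poset_least[of a a] by (auto simp: pd_poset_def pd_le_refl)

lemma pd_poset_greatest: "b \<in> pd_poset a \<Longrightarrow> pd_le b a" "a \<in> pd_poset a"
  by (auto simp: pd_poset_def pd_le_refl)

lemma finite_pd_poset: "finite (pd_poset a)"
proof (rule finite_subset)
  show "pd_poset a \<subseteq> {b. set b \<subseteq> {..Max (set a)} \<and> length b = length a}"
  proof
    fix b assume b: "b \<in> pd_poset a"
    then have len: "length b = length a" by (rule length_pd_poset)
    have "x \<le> Max (set a)" if x: "x \<in> set b" for x
    proof -
      obtain i where i: "i < length a" "x = b ! i"
        using x len by (auto simp: in_set_conv_nth)
      have "b ! i \<le> a ! i"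
        using b i by (auto simp: pd_poset_def pd_le_def properly_divides_nth)
      also have "a ! i \<le> Max (set a)" using i by simp
      finally show ?thesis using i by simp
    qed
    with len show "b \<in> {b. set b \<subseteq> {..Max (set a)} \<and> length b = length a}" by auto
  qed
  show "finite {b. set b \<subseteq> {..Max (set a)} \<and> length b = length a}"
    by (rule finite_lists_length_eq) simp
qed

text \<open>An abstract complex is the set of its faces. The empty face always belongs to it, so the
  smallest complex is \<open>{{}}\<close>, of dimension \<open>-1\<close>.\<close>

definition finite_complex :: "'a set set \<Rightarrow> bool" where
  "finite_complex K \<longleftrightarrow> finite K \<and> {} \<in> K \<and> (\<forall>F\<in>K. finite F \<and> Pow F \<subseteq> K)"

definition face_dim :: "'a set \<Rightarrow> int" where
  "face_dim F = int (card F) - 1"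

definition facets :: "'a set set \<Rightarrow> 'a set set" where
  "facets K = {F \<in> K. \<forall>G\<in>K. F \<subseteq> G \<longrightarrow> F = G}"

definition pure_complex :: "int \<Rightarrow> 'a set set \<Rightarrow> bool" where
  "pure_complex d K \<longleftrightarrow> finite_complex K \<and> (\<forall>F\<in>facets K. face_dim F = d)"

text \<open>The facets are listed from index 0, so the condition is imposed from index 1 onwards.\<close>

definition shellable :: "'a set set \<Rightarrow> bool" where
  "shellable K \<longleftrightarrow> finite_complex K \<and>
     (\<exists>Fs. distinct Fs \<and> set Fs = facets K \<and>
       (\<forall>j. 1 \<le> j \<and> j < length Fs \<longrightarrow>
          pure_complex (face_dim (Fs ! j) - 1) ((\<Union>i<j. Pow (Fs ! i)) \<inter> Pow (Fs ! j))))"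

definition proper_part :: "('a \<Rightarrow> 'a \<Rightarrow> bool) \<Rightarrow> 'a set \<Rightarrow> 'a set" where
  "proper_part r P = P - {x \<in> P. \<forall>y\<in>P. r x y} - {x \<in> P. \<forall>y\<in>P. r y x}"

definition order_complex :: "('a \<Rightarrow> 'a \<Rightarrow> bool) \<Rightarrow> 'a set \<Rightarrow> 'a set set" where
  "order_complex r P = {C. C \<subseteq> proper_part r P \<and> Complete_Partial_Order.chain r C}"

lemma proper_part_pd_poset:
  "proper_part pd_le (pd_poset a) = pd_poset a - {replicate (length a) 0, a}"
proof -
  have "{x \<in> pd_poset a. \<forall>y\<in>pd_poset a. pd_le x y} = {replicate (length a) 0}"
    using zero_in_pd_poset[of a] pd_poset_least[of _ a] pd_le_antisym by blast
  moreover have "{x \<in> pd_poset a. \<forall>y\<in>pd_poset a. pd_le y x} = {a}"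
    using pd_poset_greatest(1)[of _ a] pd_poset_greatest(2)[of a] pd_le_antisym by blast
  ultimately show ?thesis unfolding proper_part_def by blast
qed

lemma finite_complex_order_complex:
  assumes "finite P"
  shows "finite_complex (order_complex r P)"
proof -
  have fin: "finite (proper_part r P)"
    using assms by (simp add: proper_part_def)
  then have "finite (order_complex r P)"
    by (rule_tac B = "Pow (proper_part r P)" in finite_subset) (auto simp: order_complex_def)
  then show ?thesis
    using fin by (auto simp: finite_complex_def order_complex_def
        Complete_Partial_Order.chain_def intro: finite_subset)
qed

text \<open>Points are given by barycentric coordinates. For a finite complex the product topology
  induces the usual topology of the realization.\<close>

definition realization :: "'a set set \<Rightarrow> ('a \<Rightarrow> real) topology" where
  "realization K = subtopology (powertop_real UNIV)
     {x. (\<forall>v. 0 \<le> x v) \<and> {v. x v \<noteq> 0} \<in> K \<and> (\<Sum>v | x v \<noteq> 0. x v) = 1}"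

text \<open>In the wedge of the pointed spaces \<open>(X i, p i)\<close>, the common base point is \<open>None\<close>. The topology
  is the final one for the canonical maps from the \<open>X i\<close>. The empty wedge is a point.\<close>

definition wedge_map :: "('i \<Rightarrow> 'a) \<Rightarrow> 'i \<times> 'a \<Rightarrow> ('i \<times> 'a) option" where
  "wedge_map p = (\<lambda>(i, x). if x = p i then None else Some (i, x))"

definition wedge :: "('i \<Rightarrow> 'a topology) \<Rightarrow> ('i \<Rightarrow> 'a) \<Rightarrow> 'i set \<Rightarrow> ('i \<times> 'a) option topology" where
  "wedge X p I = topology (\<lambda>U.
     U \<subseteq> insert None (wedge_map p ` Sigma I (topspace \<circ> X)) \<and>
     (\<forall>i\<in>I. openin (X i) {x \<in> topspace (X i). wedge_map p (i, x) \<in> U}))"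

lemma openin_wedge:
  "openin (wedge X p I) U \<longleftrightarrow>
     U \<subseteq> insert None (wedge_map p ` Sigma I (topspace \<circ> X)) \<and>
     (\<forall>i\<in>I. openin (X i) {x \<in> topspace (X i). wedge_map p (i, x) \<in> U})"
proof -
  have 1: "{x \<in> topspace (X i). wedge_map p (i, x) \<in> S \<inter> T} =
      {x \<in> topspace (X i). wedge_map p (i, x) \<in> S} \<inter> {x \<in> topspace (X i). wedge_map p (i, x) \<in> T}"
    for i S T by blast
  have 2: "{x \<in> topspace (X i). wedge_map p (i, x) \<in> \<Union>\<K>} =
      (\<Union>S\<in>\<K>. {x \<in> topspace (X i). wedge_map p (i, x) \<in> S})"
    for i \<K> by blast
  have "istopology (\<lambda>U. U \<subseteq> insert None (wedge_map p ` Sigma I (topspace \<circ> X)) \<and>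
     (\<forall>i\<in>I. openin (X i) {x \<in> topspace (X i). wedge_map p (i, x) \<in> U}))"
    unfolding istopology_def 1 2 by blast
  then show ?thesis
    by (simp add: wedge_def topology_inverse')
qed

lemma topspace_wedge:
  "topspace (wedge X p I) = insert None (wedge_map p ` Sigma I (topspace \<circ> X))"
proof
  show "topspace (wedge X p I) \<subseteq> insert None (wedge_map p ` Sigma I (topspace \<circ> X))"
    using openin_wedge[of X p I] openin_topspace by blast
  have "{x \<in> topspace (X i). wedge_map p (i, x) \<in> insert None (wedge_map p ` Sigma I (topspace \<circ> X))}
      = topspace (X i)" if "i \<in> I" for i
    using that by auto
  then have "openin (wedge X p I) (insert None (wedge_map p ` Sigma I (topspace \<circ> X)))"
    by (simp add: openin_wedge)
  then show "insert None (wedge_map p ` Sigma I (topspace \<circ> X)) \<subseteq> topspace (wedge X p I)"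
    by (rule openin_subset)
qed

lemma quotient_map_wedge:
  assumes "I \<noteq> {}" and p: "\<And>i. i \<in> I \<Longrightarrow> p i \<in> topspace (X i)"
  shows "quotient_map (sum_topology X I) (wedge X p I) (wedge_map p)"
proof -
  obtain i where i: "i \<in> I" using assms by blast
  have "None \<in> wedge_map p ` Sigma I (topspace \<circ> X)"
    by (rule image_eqI[of _ _ "(i, p i)"]) (use i p in \<open>auto simp: wedge_map_def\<close>)
  then have top: "topspace (wedge X p I) = wedge_map p ` Sigma I (topspace \<circ> X)"
    by (auto simp: topspace_wedge)
  show ?thesis
    unfolding quotient_map_def
  proof (intro conjI allI impI)
    show "wedge_map p ` topspace (sum_topology X I) = topspace (wedge X p I)"
      by (simp add: top)
    fix U assume U: "U \<subseteq> topspace (wedge X p I)"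
    have eq: "{x. (i, x) \<in> {z \<in> topspace (sum_topology X I). wedge_map p z \<in> U}} =
      {x \<in> topspace (X i). wedge_map p (i, x) \<in> U}" if "i \<in> I" for i
      using that by auto
    have "openin (sum_topology X I) {z \<in> topspace (sum_topology X I). wedge_map p z \<in> U} \<longleftrightarrow>
        (\<forall>i\<in>I. openin (X i) {x \<in> topspace (X i). wedge_map p (i, x) \<in> U})"
      unfolding openin_sum_topology using eq by auto
    then show "openin (sum_topology X I) {z \<in> topspace (sum_topology X I). wedge_map p z \<in> U} =
        openin (wedge X p I) U"
      using U by (auto simp: openin_wedge top)
  qed
qed

definition sphere_wedge :: "nat list \<Rightarrow> (nat \<times> (nat \<Rightarrow> real)) option topology" where
  "sphere_wedge ds =
     wedge (\<lambda>i. nsphere (ds ! i)) (\<lambda>i j. if j = 0 then 1 else 0) {..<length ds}"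

text \<open>The first alternative is the sphere of dimension \<open>-1\<close>.\<close>

definition homotopy_wedge_of_spheres :: "'a set set \<Rightarrow> bool" where
  "homotopy_wedge_of_spheres K \<longleftrightarrow>
     K = {{}} \<or> (\<exists>ds. realization K homotopy_equivalent_space sphere_wedge ds)"

lemma sphere_basepoint: "(\<lambda>j. if j = 0 then 1 else 0) \<in> topspace (nsphere d)"
proof -
  have "(\<Sum>i\<le>d. (if i = (0::nat) then 1 else 0 :: real)\<^sup>2) = (\<Sum>i\<le>d. if i = 0 then 1 else 0)"
    by (intro sum.cong) auto
  then show ?thesis by (simp add: nsphere)
qed

text \<open>Integral oriented \<open>k\<close>-chains: a chain assigns to each ordering \<open>[v\<^sub>0, \<dots>, v\<^sub>k]\<close> of a \<open>k\<close>-face its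
  coefficient at the oriented simplex \<open>[v\<^sub>0, \<dots>, v\<^sub>k]\<close>, and changes sign under transpositions. The
  oriented simplex itself is the chain taking the sign of \<open>\<sigma>\<close> as its value on
  \<open>[v\<^sub>\<sigma>\<^sub>0, \<dots>, v\<^sub>\<sigma>\<^sub>k]\<close>. Its boundary in the definition below is
  \<open>\<Sum>i\<le>k. (-1)^i [v\<^sub>0, \<dots>, v\<^sub>i\<^sub>-\<^sub>1, v\<^sub>i\<^sub>+\<^sub>1, \<dots>, v\<^sub>k]\<close>, as \<open>v\<^sub>i\<close> can be moved to the front by \<open>i\<close> transpositions.
  The empty face is the only one of dimension \<open>-1\<close>, and the boundary from dimension 0 to
  dimension \<open>-1\<close> is the augmentation, so the homology is reduced.\<close>

definition oriented_chains :: "'a set set \<Rightarrow> int \<Rightarrow> ('a list \<Rightarrow> int) set" where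
  "oriented_chains K k = {c.
     (\<forall>vs. c vs \<noteq> 0 \<longrightarrow> distinct vs \<and> set vs \<in> K \<and> face_dim (set vs) = k) \<and>
     (\<forall>xs u v ys. c (xs @ u # v # ys) = - c (xs @ v # u # ys))}"

definition oriented_chain_group :: "'a set set \<Rightarrow> int \<Rightarrow> ('a list \<Rightarrow> int) monoid" where
  "oriented_chain_group K k =
     \<lparr>carrier = oriented_chains K k, mult = (\<lambda>c d vs. c vs + d vs), one = (\<lambda>vs. 0)\<rparr>"

definition oriented_boundary :: "'a set set \<Rightarrow> ('a list \<Rightarrow> int) \<Rightarrow> 'a list \<Rightarrow> int" where
  "oriented_boundary K c = (\<lambda>vs. \<Sum>v\<in>\<Union>K. c (v # vs))"

definition oriented_cycles :: "'a set set \<Rightarrow> int \<Rightarrow> ('a list \<Rightarrow> int) set" where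
  "oriented_cycles K k = {c \<in> oriented_chains K k. oriented_boundary K c = (\<lambda>vs. 0)}"

definition oriented_boundaries :: "'a set set \<Rightarrow> int \<Rightarrow> ('a list \<Rightarrow> int) set" where
  "oriented_boundaries K k = oriented_boundary K ` oriented_chains K (k + 1)"

definition reduced_simplicial_homology :: "'a set set \<Rightarrow> int \<Rightarrow> ('a list \<Rightarrow> int) set monoid" where
  "reduced_simplicial_homology K k =
     (oriented_chain_group K k)\<lparr>carrier := oriented_cycles K k\<rparr> Mod oriented_boundaries K k"

definition torsion_free_group :: "('g, 'm) monoid_scheme \<Rightarrow> bool" where
  "torsion_free_group G \<longleftrightarrow>
     (\<forall>x\<in>carrier G. \<forall>m::nat. 0 < m \<and> x [^]\<^bsub>G\<^esub> m = \<one>\<^bsub>G\<^esub> \<longrightarrow> x = \<one>\<^bsub>G\<^esub>)"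

lemma oriented_chains_swap:
  "c \<in> oriented_chains K k \<Longrightarrow> c (xs @ u # v # ys) = - c (xs @ v # u # ys)"
  unfolding oriented_chains_def by blast

lemma oriented_chains_zero: "(\<lambda>vs. 0) \<in> oriented_chains K k"
  by (simp add: oriented_chains_def)

lemma oriented_chains_add:
  assumes "c \<in> oriented_chains K k" "d \<in> oriented_chains K k"
  shows "(\<lambda>vs. c vs + d vs) \<in> oriented_chains K k"
proof -
  have "distinct vs \<and> set vs \<in> K \<and> face_dim (set vs) = k" if "c vs + d vs \<noteq> 0" for vs
    using that assms by (cases "c vs = 0") (auto simp: oriented_chains_def)
  moreover have "c (xs @ u # v # ys) + d (xs @ u # v # ys) =
      - (c (xs @ v # u # ys) + d (xs @ v # u # ys))" for xs u v ys
  proof -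
    have "c (xs @ u # v # ys) = - c (xs @ v # u # ys)" "d (xs @ u # v # ys) = - d (xs @ v # u # ys)"
      by (rule oriented_chains_swap[OF assms(1)], rule oriented_chains_swap[OF assms(2)])
    then show ?thesis by linarith
  qed
  ultimately show ?thesis unfolding oriented_chains_def by blast
qed

lemma oriented_chains_uminus:
  assumes "c \<in> oriented_chains K k"
  shows "(\<lambda>vs. - c vs) \<in> oriented_chains K k"
proof -
  have "- c (xs @ u # v # ys) = - (- c (xs @ v # u # ys))" for xs u v ys
    using oriented_chains_swap[OF assms, of xs u v ys] by linarith
  moreover have "\<forall>vs. - c vs \<noteq> 0 \<longrightarrow> distinct vs \<and> set vs \<in> K \<and> face_dim (set vs) = k"
    using assms by (auto simp: oriented_chains_def)
  ultimately show ?thesis unfolding oriented_chains_def by blast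
qed

lemma comm_group_oriented_chain_group: "comm_group (oriented_chain_group K k)"
proof (rule comm_groupI)
  fix c assume "c \<in> carrier (oriented_chain_group K k)"
  then show "\<exists>d\<in>carrier (oriented_chain_group K k).
      d \<otimes>\<^bsub>oriented_chain_group K k\<^esub> c = \<one>\<^bsub>oriented_chain_group K k\<^esub>"
    by (intro bexI[of _ "\<lambda>vs. - c vs"])
      (auto simp: oriented_chain_group_def oriented_chains_uminus)
qed (simp_all add: oriented_chain_group_def oriented_chains_zero oriented_chains_add ac_simps)

lemma oriented_boundary_add:
  "oriented_boundary K (\<lambda>vs. c vs + d vs) =
     (\<lambda>vs. oriented_boundary K c vs + oriented_boundary K d vs)"
  by (simp add: oriented_boundary_def sum.distrib)

lemma oriented_boundary_zero: "oriented_boundary K (\<lambda>vs. 0) = (\<lambda>vs. 0)"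
  by (simp add: oriented_boundary_def)

lemma oriented_boundary_uminus:
  "oriented_boundary K (\<lambda>vs. - c vs) = (\<lambda>vs. - oriented_boundary K c vs)"
  by (simp add: oriented_boundary_def sum_negf)

lemma oriented_boundary_in_chains:
  assumes K: "finite_complex K" and c: "c \<in> oriented_chains K (k + 1)"
  shows "oriented_boundary K c \<in> oriented_chains K k"
proof -
  have "distinct vs \<and> set vs \<in> K \<and> face_dim (set vs) = k"
    if nz: "oriented_boundary K c vs \<noteq> 0" for vs
  proof -
    obtain v where "c (v # vs) \<noteq> 0"
      using nz sum.neutral[of "\<Union>K" "\<lambda>v. c (v # vs)"] by (auto simp: oriented_boundary_def)
    then have v: "distinct (v # vs)" "set (v # vs) \<in> K" "face_dim (set (v # vs)) = k + 1"
      using c unfolding oriented_chains_def by blast+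
    have "Pow (set (v # vs)) \<subseteq> K"
      using v(2) K unfolding finite_complex_def by blast
    then have "set vs \<in> K" by auto
    moreover have "face_dim (set vs) = k"
      using v by (simp add: face_dim_def)
    ultimately show ?thesis using v by simp
  qed
  moreover have "oriented_boundary K c (xs @ u # v # ys) = - oriented_boundary K c (xs @ v # u # ys)"
    for xs u v ys
  proof -
    have "c ((w # xs) @ u # v # ys) = - c ((w # xs) @ v # u # ys)" for w
      by (rule oriented_chains_swap[OF c])
    then show ?thesis
      by (simp add: oriented_boundary_def sum_negf)
  qed
  ultimately show ?thesis unfolding oriented_chains_def by blast
qed

lemma oriented_boundary_boundary:
  assumes c: "c \<in> oriented_chains K k"
  shows "oriented_boundary K (oriented_boundary K c) = (\<lambda>vs. 0)"
proof
  fix vs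
  let ?S = "\<Sum>v\<in>\<Union>K. \<Sum>u\<in>\<Union>K. c (u # v # vs)"
  have swap: "c (u # v # vs) = - c (v # u # vs)" for u v
    using oriented_chains_swap[OF c, of "[]" u v vs] by simp
  have "?S = (\<Sum>v\<in>\<Union>K. \<Sum>u\<in>\<Union>K. - c (v # u # vs))"
    by (intro sum.cong refl swap)
  also have "\<dots> = - ?S"
    unfolding sum_negf by (subst sum.swap) simp
  finally show "oriented_boundary K (oriented_boundary K c) vs = 0"
    by (simp add: oriented_boundary_def)
qed

lemma comm_group_reduced_simplicial_homology:
  assumes K: "finite_complex K"
  shows "comm_group (reduced_simplicial_homology K k)"
proof -
  let ?C = "oriented_chain_group K k"
  let ?Z = "?C\<lparr>carrier := oriented_cycles K k\<rparr>"
  have Z: "comm_group ?Z"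
  proof (rule comm_groupI)
    fix c assume "c \<in> carrier ?Z"
    then show "\<exists>d\<in>carrier ?Z. d \<otimes>\<^bsub>?Z\<^esub> c = \<one>\<^bsub>?Z\<^esub>"
      by (intro bexI[of _ "\<lambda>vs. - c vs"])
        (auto simp: oriented_chain_group_def oriented_cycles_def oriented_chains_uminus
          oriented_boundary_uminus)
  qed (simp_all add: oriented_chain_group_def oriented_cycles_def oriented_chains_zero
      oriented_chains_add oriented_boundary_add oriented_boundary_zero ac_simps)
  then interpret Z: comm_group ?Z .
  have sub: "oriented_boundaries K k \<subseteq> carrier ?Z"
    using oriented_boundary_in_chains[OF K] oriented_boundary_boundary
    by (auto simp: oriented_boundaries_def oriented_cycles_def)
  have "subgroup (oriented_boundaries K k) ?Z"
  proof (rule Z.subgroupI[OF sub])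
    show "oriented_boundaries K k \<noteq> {}"
      using oriented_chains_zero by (auto simp: oriented_boundaries_def)
  next
    fix b assume b: "b \<in> oriented_boundaries K k"
    then obtain c where c: "c \<in> oriented_chains K (k + 1)" "b = oriented_boundary K c"
      by (auto simp: oriented_boundaries_def)
    have nb: "(\<lambda>vs. - b vs) \<in> oriented_boundaries K k"
      using c oriented_chains_uminus[OF c(1)] oriented_boundary_uminus[of K c]
      unfolding oriented_boundaries_def by (metis image_eqI)
    have "inv\<^bsub>?Z\<^esub> b = (\<lambda>vs. - b vs)"
      by (rule Z.inv_equality) (use sub b nb in \<open>auto simp: oriented_chain_group_def\<close>)
    with nb show "inv\<^bsub>?Z\<^esub> b \<in> oriented_boundaries K k" by simp
  next
    fix b b' assume "b \<in> oriented_boundaries K k" "b' \<in> oriented_boundaries K k"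
    then obtain c c' where "c \<in> oriented_chains K (k + 1)" "b = oriented_boundary K c"
      "c' \<in> oriented_chains K (k + 1)" "b' = oriented_boundary K c'"
      by (auto simp: oriented_boundaries_def)
    then show "b \<otimes>\<^bsub>?Z\<^esub> b' \<in> oriented_boundaries K k"
      using oriented_boundary_add[of K c c'] oriented_chains_add[of c K "k + 1" c']
      unfolding oriented_boundaries_def
      by (auto simp: oriented_chain_group_def intro!: image_eqI[of _ _ "\<lambda>vs. c vs + c' vs"])
  qed
  then show ?thesis
    unfolding reduced_simplicial_homology_def by (rule Z.abelian_FactGroup)
qed

end

theory Submission
  imports Defs
begin

text \<open>
  Write \<open>b\<^sup>-\<close> for the vector obtained from \<open>b\<close> by lowering every positive entry by one. If
  \<open>z < y < b\<close> in the order of proper divisibility, then \<open>z\<close> lies strictly below \<open>b\<^sup>-\<close> as well: an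
  entry either grows twice on the way from \<open>z\<close> to \<open>b\<close>, or it is \<open>0\<close> in \<open>z\<close>. So if the open
  interval \<open>(0, b)\<close> is not empty, then \<open>b\<^sup>-\<close> is one of its maximal elements, and \<open>(0, c)\<close> is contained in
  \<open>(0, b\<^sup>-)\<close> for every other maximal element \<open>c\<close>. Hence the order complex \<open>K(b)\<close> of \<open>(0, b)\<close> is
  the cone over \<open>K(b\<^sup>-)\<close> with apex \<open>b\<^sup>-\<close>, to which, for each of these \<open>c\<close>, a cone with apex \<open>c\<close>
  is attached along its full base \<open>K(c) \<subseteq> K(b\<^sup>-)\<close>. Listing the facets cone by cone, each cone in the
  order given by recursion, is a shelling (\<open>shelling_below\<close>).

  The two topological statements hold for every shellable complex \<open>K\<close>. When a facet \<open>F\<close> is added in a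
  shelling, the new faces are exactly those between \<open>F\<close> and a restriction set \<open>R \<subseteq> F\<close>. If \<open>R \<noteq> F\<close>,
  adding them is the inverse of a collapse: the new faces come in pairs \<open>G\<close>, \<open>G \<union> {v}\<close> for any fixed
  \<open>v \<in> F - R\<close>. If \<open>R = F\<close>, only \<open>F\<close> itself is new. As no facet contains another one, the facets of
  the second kind can be left out throughout, so \<open>K\<close> is a subcomplex \<open>L\<close> built by inverse collapses
  together with a set \<open>H\<close> of facets (\<open>shellable_decomposition\<close>). The complex \<open>L\<close> is acyclic,
  and contractible when it is not void.

  Torsion-freeness follows: if a positive multiple of a cycle \<open>z\<close> is a boundary, then \<open>z\<close> vanishes on \<open>H\<close>,
  because no facet is a proper face of another simplex; so \<open>z\<close> is a cycle of \<open>L\<close>, hence a boundary.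

  For the homotopy type, the quotient of the realization \<open>|K|\<close> by \<open>|L|\<close> is a wedge of spheres,
  one for each element of \<open>H\<close>, since a simplex modulo its boundary is a sphere; the map
  \<open>simplex_to_sphere\<close> makes this explicit. By the homotopy extension property, again with explicit formulas (\<open>deform_subcomplex_to_point\<close>), a
  contraction of \<open>|L|\<close> extends to a homotopy of the identity of \<open>|K|\<close> under which \<open>|L|\<close> stays within
  itself. Such a homotopy descends to the quotient, so the quotient map is a homotopy equivalence
  (\<open>quotient_homotopy_equivalence\<close>).
\<close>

section \<open>Shellings and restriction sets\<close>

text \<open>The facets are added to a given set \<open>A\<close> of old faces, so that shellings of the parts of a complex can
  be concatenated. The set \<open>R\<close> is the restriction set of \<open>F\<close>: a face of \<open>F\<close> is new iff it contains \<open>R\<close>.\<close>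

primrec shelling_over :: "'a set set \<Rightarrow> 'a set list \<Rightarrow> bool" where
  "shelling_over A [] \<longleftrightarrow> True"
| "shelling_over A (F # Fs) \<longleftrightarrow>
     (\<exists>R\<subseteq>F. \<forall>G\<subseteq>F. G \<in> A \<longleftrightarrow> \<not> R \<subseteq> G) \<and> shelling_over (A \<union> Pow F) Fs"

lemma shelling_over_append:
  "shelling_over A (Es @ Fs) \<longleftrightarrow>
     shelling_over A Es \<and> shelling_over (A \<union> (\<Union>E\<in>set Es. Pow E)) Fs"
  by (induction Es arbitrary: A) (simp_all add: Un_assoc conj_assoc)

lemma shelling_over_new: "shelling_over A Fs \<Longrightarrow> F \<in> set Fs \<Longrightarrow> F \<notin> A"
proof (induction Fs arbitrary: A)
  case (Cons E Fs)
  then show ?case by (cases "F = E") auto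
qed simp

lemma shelling_over_distinct: "shelling_over A Fs \<Longrightarrow> distinct Fs"
proof (induction Fs arbitrary: A)
  case (Cons F Fs)
  then show ?case using shelling_over_new[of "A \<union> Pow F" Fs F] by auto
qed simp

lemma shelling_over_nth:
  "shelling_over A Fs \<longleftrightarrow> (\<forall>j<length Fs. \<exists>R\<subseteq>Fs ! j. \<forall>G\<subseteq>Fs ! j.
     G \<in> A \<union> (\<Union>i<j. Pow (Fs ! i)) \<longleftrightarrow> \<not> R \<subseteq> G)"
proof (induction Fs arbitrary: A)
  case (Cons F Fs)
  have *: "A \<union> Pow F \<union> (\<Union>i<j. Pow (Fs ! i)) = A \<union> (\<Union>i<Suc j. Pow ((F # Fs) ! i))" for j
    by (simp only: lessThan_Suc_eq_insert_0) auto
  show ?case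
    by (simp only: shelling_over.simps Cons.IH length_Cons All_less_Suc2 nth_Cons_0 nth_Cons_Suc *)
      simp
qed simp

lemma face_in_facet:
  assumes "finite K" "G \<in> K"
  obtains F where "F \<in> facets K" "G \<subseteq> F"
proof -
  obtain F where "F \<in> K" "G \<subseteq> F" "\<forall>E\<in>K. F \<subseteq> E \<longrightarrow> F = E"
    using finite_has_maximal2[OF assms] by auto
  then show ?thesis using that by (auto simp: facets_def)
qed

text \<open>The restriction set consists of the vertices of \<open>F\<close> whose opposite codimension-one face is old.
  Purity says that every old face of \<open>F\<close> lies in such an old codimension-one face, that is, that it misses
  a vertex of \<open>R\<close>.\<close>

lemma pure_intersection_iff:
  assumes F: "finite F" and A: "{} \<in> A" "\<And>G H. G \<in> A \<Longrightarrow> H \<subseteq> G \<Longrightarrow> H \<in> A"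
  shows "pure_complex (face_dim F - 1) (A \<inter> Pow F) \<longleftrightarrow> (\<exists>R\<subseteq>F. \<forall>G\<subseteq>F. G \<in> A \<longleftrightarrow> \<not> R \<subseteq> G)"
proof
  assume pure: "pure_complex (face_dim F - 1) (A \<inter> Pow F)"
  define R where "R = {v \<in> F. F - {v} \<in> A}"
  have "G \<in> A \<longleftrightarrow> \<not> R \<subseteq> G" if G: "G \<subseteq> F" for G
  proof
    assume "G \<in> A"
    then obtain E where E: "E \<in> facets (A \<inter> Pow F)" "G \<subseteq> E"
      using face_in_facet[of "A \<inter> Pow F" G] F G by blast
    then have "E \<in> A" "E \<subseteq> F" "face_dim E = face_dim F - 1"
      using pure by (auto simp: pure_complex_def facets_def)
    then have "card (F - E) = 1"
      using F by (simp add: face_dim_def card_Diff_subset finite_subset)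
    then obtain v where "F - E = {v}"
      using card_1_singletonE by blast
    then have "v \<in> F" "v \<notin> E" "E = F - {v}" using \<open>E \<subseteq> F\<close> by auto
    then show "\<not> R \<subseteq> G" using \<open>E \<in> A\<close> E(2) by (auto simp: R_def)
  next
    assume "\<not> R \<subseteq> G"
    then obtain v where v: "v \<in> F" "F - {v} \<in> A" "v \<notin> G" by (auto simp: R_def)
    then have "G \<subseteq> F - {v}" using G by auto
    then show "G \<in> A" using A(2)[OF v(2)] by simp
  qed
  moreover have "R \<subseteq> F" by (auto simp: R_def)
  ultimately show "\<exists>R\<subseteq>F. \<forall>G\<subseteq>F. G \<in> A \<longleftrightarrow> \<not> R \<subseteq> G" by blast
next
  assume "\<exists>R\<subseteq>F. \<forall>G\<subseteq>F. G \<in> A \<longleftrightarrow> \<not> R \<subseteq> G"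
  then obtain R where R: "R \<subseteq> F" "\<And>G. G \<subseteq> F \<Longrightarrow> G \<in> A \<longleftrightarrow> \<not> R \<subseteq> G" by blast
  have "finite_complex (A \<inter> Pow F)"
    using F A by (auto simp: finite_complex_def dest: finite_subset)
  moreover have "face_dim E = face_dim F - 1" if E: "E \<in> facets (A \<inter> Pow F)" for E
  proof -
    have EF: "E \<in> A" "E \<subseteq> F" using E by (auto simp: facets_def)
    then obtain v where v: "v \<in> R" "v \<notin> E" using R(2) by blast
    have "F - {v} \<in> A \<inter> Pow F" using R(2)[of "F - {v}"] v by auto
    moreover have "E \<subseteq> F - {v}" using EF v by auto
    ultimately have "E = F - {v}" using E by (auto simp: facets_def)
    then have "F = insert v E" using v R(1) by auto
    then show ?thesis using v F by (simp add: face_dim_def)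
  qed
  ultimately show "pure_complex (face_dim F - 1) (A \<inter> Pow F)"
    by (simp add: pure_complex_def)
qed

lemma shellable_iff:
  assumes K: "finite_complex K"
  shows "shellable K \<longleftrightarrow> (\<exists>Fs. set Fs = facets K \<and> shelling_over {} Fs)"
proof -
  have "(\<forall>j. 1 \<le> j \<and> j < length Fs \<longrightarrow>
       pure_complex (face_dim (Fs ! j) - 1) ((\<Union>i<j. Pow (Fs ! i)) \<inter> Pow (Fs ! j))) \<longleftrightarrow>
     shelling_over {} Fs" if Fs: "set Fs = facets K" for Fs
  proof -
    have step: "pure_complex (face_dim (Fs ! j) - 1) ((\<Union>i<j. Pow (Fs ! i)) \<inter> Pow (Fs ! j)) \<longleftrightarrow>
       (\<exists>R\<subseteq>Fs ! j. \<forall>G\<subseteq>Fs ! j. G \<in> {} \<union> (\<Union>i<j. Pow (Fs ! i)) \<longleftrightarrow> \<not> R \<subseteq> G)"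
      if j: "1 \<le> j" "j < length Fs" for j
    proof -
      have "Fs ! j \<in> K" using Fs j nth_mem[of j Fs] by (auto simp: facets_def)
      then have "finite (Fs ! j)" using K by (auto simp: finite_complex_def)
      then show ?thesis
        using j by (subst pure_intersection_iff) (auto intro!: exI[of _ 0])
    qed
    have "\<exists>R\<subseteq>Fs ! 0. \<forall>G\<subseteq>Fs ! 0. G \<in> {} \<union> (\<Union>i<0. Pow (Fs ! i)) \<longleftrightarrow> \<not> R \<subseteq> G"
      by (intro exI[of _ "{}"]) auto
    then show ?thesis
      unfolding shelling_over_nth using step
      by (metis One_nat_def Suc_leI gr0I)
  qed
  then show ?thesis
    using K shelling_over_distinct unfolding shellable_def by blast
qed

section \<open>Posets whose lower intervals are dominated by one coatom\<close>

text \<open>Coning a shelled complex preserves restriction sets: over an apex \<open>c\<close>, a face is old iff its part in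
  the base is.\<close>

lemma shelling_over_insert_first:
  assumes "shelling_over A Fs" "\<And>F. F \<in> set Fs \<Longrightarrow> c \<notin> F"
    and "\<And>F G. F \<in> set Fs \<Longrightarrow> G \<subseteq> F \<Longrightarrow> (G \<in> B \<longleftrightarrow> G \<in> A) \<and> (insert c G \<in> B \<longleftrightarrow> G \<in> A)"
  shows "shelling_over B (map (insert c) Fs)"
  using assms
proof (induction Fs arbitrary: A B)
  case (Cons F Fs)
  obtain R where R: "R \<subseteq> F" "\<And>G. G \<subseteq> F \<Longrightarrow> G \<in> A \<longleftrightarrow> \<not> R \<subseteq> G"
    using Cons.prems(1) by auto
  have c: "c \<notin> F" using Cons.prems(2) by simp
  have "H \<in> B \<longleftrightarrow> \<not> R \<subseteq> H" if H: "H \<subseteq> insert c F" for H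
  proof -
    have sub: "H - {c} \<subseteq> F" using H by auto
    have "H = H - {c} \<or> H = insert c (H - {c})" by auto
    then have "H \<in> B \<longleftrightarrow> H - {c} \<in> A"
      using Cons.prems(3)[of F "H - {c}"] sub by (metis list.set_intros(1))
    also have "\<dots> \<longleftrightarrow> \<not> R \<subseteq> H" using R(2)[OF sub] R(1) c by auto
    finally show ?thesis .
  qed
  moreover have "shelling_over (B \<union> Pow (insert c F)) (map (insert c) Fs)"
  proof (rule Cons.IH[of "A \<union> Pow F"])
    fix E G assume "E \<in> set Fs" "G \<subseteq> E"
    moreover from this have "c \<notin> G" using Cons.prems(2) by auto
    ultimately show "(G \<in> B \<union> Pow (insert c F) \<longleftrightarrow> G \<in> A \<union> Pow F) \<and>
        (insert c G \<in> B \<union> Pow (insert c F) \<longleftrightarrow> G \<in> A \<union> Pow F)"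
      using Cons.prems(3)[of E G] by auto
  qed (use Cons.prems in auto)
  ultimately show ?case using R(1) by auto
qed simp

text \<open>If the base of the cone consists of old faces, the apex \<open>c\<close> has to be put into the restriction set:
  every face of the cone without \<open>c\<close> is old.\<close>

lemma shelling_over_insert_later:
  assumes "shelling_over A Fs" "\<And>F. F \<in> set Fs \<Longrightarrow> c \<notin> F"
    and "\<And>F G. F \<in> set Fs \<Longrightarrow> G \<subseteq> F \<Longrightarrow> G \<in> B \<and> (insert c G \<in> B \<longleftrightarrow> G \<in> A)"
  shows "shelling_over B (map (insert c) Fs)"
  using assms
proof (induction Fs arbitrary: A B)
  case (Cons F Fs)
  obtain R where R: "R \<subseteq> F" "\<And>G. G \<subseteq> F \<Longrightarrow> G \<in> A \<longleftrightarrow> \<not> R \<subseteq> G"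
    using Cons.prems(1) by auto
  have "H \<in> B \<longleftrightarrow> \<not> insert c R \<subseteq> H" if H: "H \<subseteq> insert c F" for H
  proof (cases "c \<in> H")
    case True
    have sub: "H - {c} \<subseteq> F" using H by auto
    have "H \<in> B \<longleftrightarrow> H - {c} \<in> A"
      using Cons.prems(3)[of F "H - {c}"] sub True by (simp add: insert_absorb)
    also have "\<dots> \<longleftrightarrow> \<not> insert c R \<subseteq> H" using R(2)[OF sub] R(1) True Cons.prems(2) by auto
    finally show ?thesis .
  next
    case False
    then have "H \<subseteq> F" using H by auto
    then show ?thesis using Cons.prems(3)[of F H] False by auto
  qed
  moreover have "shelling_over (B \<union> Pow (insert c F)) (map (insert c) Fs)"
  proof (rule Cons.IH[of "A \<union> Pow F"])
    fix E G assume "E \<in> set Fs" "G \<subseteq> E"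
    moreover from this have "c \<notin> G" using Cons.prems(2) by auto
    ultimately show "G \<in> B \<union> Pow (insert c F) \<and>
        (insert c G \<in> B \<union> Pow (insert c F) \<longleftrightarrow> G \<in> A \<union> Pow F)"
      using Cons.prems(3)[of E G] by auto
  qed (use Cons.prems in auto)
  ultimately show ?case using R(1) by (auto intro!: exI[of _ "insert c R"])
qed simp

definition chains_of :: "('a \<Rightarrow> 'a \<Rightarrow> bool) \<Rightarrow> 'a set \<Rightarrow> 'a set set" where
  "chains_of r I = {C. C \<subseteq> I \<and> Complete_Partial_Order.chain r C}"

text \<open>The set \<open>P\<close> serves to leave out a least element of the order, so that the elements strictly below \<open>x\<close>
  form an open interval.\<close>

definition strictly_below :: "('a \<Rightarrow> 'a \<Rightarrow> bool) \<Rightarrow> 'a set \<Rightarrow> 'a \<Rightarrow> 'a set" where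
  "strictly_below r P x = {y \<in> P. r y x \<and> y \<noteq> x}"

locale finitary_poset =
  fixes r :: "'a \<Rightarrow> 'a \<Rightarrow> bool" and P :: "'a set"
  assumes refl: "r x x"
    and antisym: "r x y \<Longrightarrow> r y x \<Longrightarrow> x = y"
    and trans: "r x y \<Longrightarrow> r y z \<Longrightarrow> r x z"
    and finite_below: "finite (strictly_below r P x)"
begin

abbreviation below :: "'a \<Rightarrow> 'a set" where
  "below \<equiv> strictly_below r P"

definition coatoms :: "'a \<Rightarrow> 'a set" where
  "coatoms x = {c \<in> below x. \<forall>d\<in>below x. c \<notin> below d}"

lemma below_trans: "y \<in> below x \<Longrightarrow> z \<in> below y \<Longrightarrow> z \<in> below x"
  unfolding strictly_below_def using trans antisym by blast

lemma not_below_self: "x \<notin> below x"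
  by (simp add: strictly_below_def)

lemma chain_insert_top:
  assumes "c \<in> below x"
  shows "insert c C \<in> chains_of r (below x) \<and> C \<subseteq> below c \<longleftrightarrow> C \<in> chains_of r (below c)"
  using assms refl below_trans[OF assms]
  by (auto simp: chains_of_def Complete_Partial_Order.chain_def strictly_below_def)

lemma chain_top:
  assumes C: "C \<in> chains_of r (below x)" and "C \<noteq> {}"
  obtains c where "c \<in> C" "C - {c} \<in> chains_of r (below c)"
proof -
  have fin: "finite C" using C finite_below by (auto simp: chains_of_def intro: finite_subset)
  from fin \<open>C \<noteq> {}\<close> C have "\<exists>c\<in>C. \<forall>d\<in>C. r d c"
  proof (induction C rule: finite_ne_induct)
    case (singleton x)
    then show ?case using refl by auto
  next
    case (insert y C)
    then obtain c where c: "c \<in> C" "\<forall>d\<in>C. r d c"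
      by (auto simp: chains_of_def Complete_Partial_Order.chain_def)
    have "r y c \<or> r c y" using insert.prems c
      by (auto simp: chains_of_def Complete_Partial_Order.chain_def)
    then show ?case using c refl trans by (metis insert_iff)
  qed
  then obtain c where "c \<in> C" "\<forall>d\<in>C. r d c" by blast
  then have "c \<in> C" "C - {c} \<in> chains_of r (below c)"
    using C by (auto simp: chains_of_def Complete_Partial_Order.chain_def strictly_below_def)
  then show ?thesis using that by blast
qed

text \<open>A maximal chain is not empty, and its top element is a coatom, because it could be extended upwards
  otherwise.\<close>

lemma facets_below:
  assumes "below x \<noteq> {}"
  shows "facets (chains_of r (below x)) =
    (\<Union>c\<in>coatoms x. insert c ` facets (chains_of r (below c)))" (is "?A = ?B")
proof
  show "?A \<subseteq> ?B"
  proof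
    fix C assume C: "C \<in> ?A"
    then have Ch: "C \<in> chains_of r (below x)" by (auto simp: facets_def)
    have max: "C = D" if "D \<in> chains_of r (below x)" "C \<subseteq> D" for D
      using C that by (auto simp: facets_def)
    have "C \<noteq> {}"
    proof
      assume "C = {}"
      moreover obtain y where "y \<in> below x" using assms by auto
      ultimately show False
        using max[of "{y}"] refl by (auto simp: chains_of_def Complete_Partial_Order.chain_def)
    qed
    then obtain c where c: "c \<in> C" "C - {c} \<in> chains_of r (below c)"
      using chain_top[OF Ch] by blast
    have cx: "c \<in> below x" using c Ch by (auto simp: chains_of_def)
    have "c \<notin> below d" if d: "d \<in> below x" for d
    proof
      assume cd: "c \<in> below d"
      have "C - {c} \<subseteq> below c" using c(2) by (auto simp: chains_of_def)
      then have "C \<subseteq> below d" using cd below_trans by blast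
      then have "insert d C \<in> chains_of r (below x)"
        using chain_insert_top[OF d, of C] Ch by (auto simp: chains_of_def)
      then have "d \<in> C" using max by blast
      with \<open>C \<subseteq> below d\<close> show False using not_below_self by auto
    qed
    then have "c \<in> coatoms x" using cx by (auto simp: coatoms_def)
    moreover have "C - {c} \<in> facets (chains_of r (below c))"
      unfolding facets_def
    proof (intro CollectI conjI ballI impI c)
      fix D assume D: "D \<in> chains_of r (below c)" "C - {c} \<subseteq> D"
      then have "C = insert c D" using max[of "insert c D"] chain_insert_top[OF cx, of D] by auto
      moreover have "c \<notin> D" using D not_below_self by (auto simp: chains_of_def)
      ultimately show "C - {c} = D" by auto
    qed
    moreover have "C = insert c (C - {c})" using c by auto
    ultimately show "C \<in> ?B" by blast
  qed
  show "?B \<subseteq> ?A"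
  proof
    fix C assume "C \<in> ?B"
    then obtain c D where c: "c \<in> coatoms x" and D: "D \<in> facets (chains_of r (below c))"
      and C: "C = insert c D" by blast
    have cx: "c \<in> below x" using c by (auto simp: coatoms_def)
    have Dc: "D \<in> chains_of r (below c)" using D by (auto simp: facets_def)
    then have "C \<in> chains_of r (below x)" using chain_insert_top[OF cx] C by blast
    moreover have "C = E" if E: "E \<in> chains_of r (below x)" "C \<subseteq> E" for E
    proof -
      have cE: "c \<in> E" using E C by auto
      then obtain e where e: "e \<in> E" "E - {e} \<in> chains_of r (below e)"
        using chain_top[OF E(1)] by blast
      have "e \<in> below x" using e(1) E(1) by (auto simp: chains_of_def)
      then have "c \<notin> below e" using c by (auto simp: coatoms_def)
      then have "e = c" using e(2) cE by (auto simp: chains_of_def)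
      moreover have "c \<notin> D" using Dc not_below_self by (auto simp: chains_of_def)
      ultimately have "D = E - {c}"
        using D e(2) E(2) C by (auto simp: facets_def)
      then show ?thesis using C cE by auto
    qed
    ultimately show "C \<in> ?A" by (auto simp: facets_def)
  qed
qed

text \<open>The coatom \<open>m x\<close> comes first. Chains below a different coatom \<open>c\<close> are also chains below \<open>m x\<close>, so the
  cone with apex \<open>c\<close> meets all earlier ones exactly in its base, and \<open>shelling_over_insert_later\<close>
  applies. Distinct coatoms are incomparable, so no chain contains two of them.\<close>

theorem shelling_below:
  assumes m: "\<And>x. below x \<noteq> {} \<Longrightarrow> m x \<in> below x"
    and dom: "\<And>x y. y \<in> below x \<Longrightarrow> below y \<subseteq> below (m x)"
  shows "\<exists>Fs. set Fs = facets (chains_of r (below x)) \<and> shelling_over {} Fs"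
proof (induction "card (below x)" arbitrary: x rule: less_induct)
  case less
  show ?case
  proof (cases "below x = {}")
    case True
    then have "chains_of r (below x) = {{}}"
      by (auto simp: chains_of_def Complete_Partial_Order.chain_def)
    then have "set [{}] = facets (chains_of r (below x)) \<and> shelling_over {} [{}]"
      by (auto simp: facets_def)
    then show ?thesis by blast
  next
    case False
    have "\<exists>Fs. set Fs = facets (chains_of r (below c)) \<and> shelling_over {} Fs"
      if "c \<in> below x" for c
    proof (rule less.hyps)
      have "below c \<subset> below x"
        using that below_trans[OF that] not_below_self[of c] by blast
      then show "card (below c) < card (below x)"
        using finite_below by (intro psubset_card_mono)
    qed
    then obtain f where f: "\<And>c. c \<in> below x \<Longrightarrow> set (f c) = facets (chains_of r (below c))"
        "\<And>c. c \<in> below x \<Longrightarrow> shelling_over {} (f c)"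
      by metis
    have mx: "m x \<in> below x" using m[OF False] .
    have "m x \<notin> below d" if "d \<in> below x" for d
      using dom[OF that] not_below_self by blast
    then have mc: "m x \<in> coatoms x" using mx by (auto simp: coatoms_def)
    have "finite (coatoms x)"
      using finite_below[of x] by (auto simp: coatoms_def intro: finite_subset)
    then have "\<exists>cs. set cs = coatoms x - {m x} \<and> distinct cs"
      by (intro finite_distinct_list) simp
    then obtain cs where cs: "set cs = coatoms x - {m x}" "distinct cs" by blast
    have notin: "c \<notin> F" if "c \<in> below x" "F \<in> set (f c)" for c F
      using f(1)[OF that(1)] that(2) not_below_self by (auto simp: facets_def chains_of_def)
    have first: "shelling_over {} (map (insert (m x)) (f (m x)))"
      using f(2)[OF mx] notin[OF mx] by (rule shelling_over_insert_first) auto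
    \<comment> \<open>B stands for the faces of the cones that come before those with apex in ds.\<close>
    have other: "shelling_over B (concat (map (\<lambda>c. map (insert c) (f c)) ds))"
      if "set ds \<subseteq> coatoms x - {m x}" "distinct ds"
        and "chains_of r (below (m x)) \<subseteq> B" "\<And>c G. c \<in> set ds \<Longrightarrow> G \<in> B \<Longrightarrow> c \<notin> G" for ds B
      using that
    proof (induction ds arbitrary: B)
      case (Cons c ds)
      have cc: "c \<in> coatoms x" "c \<in> below x" using Cons.prems(1) by (auto simp: coatoms_def)
      have sub: "F \<subseteq> below c" if "F \<in> set (f c)" for F
        using that f(1)[OF cc(2)] by (auto simp: facets_def chains_of_def)
      have "shelling_over B (map (insert c) (f c))"
      proof (rule shelling_over_insert_later[OF f(2)[OF cc(2)] notin[OF cc(2)]])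
        fix F G assume F: "F \<in> set (f c)" "G \<subseteq> F"
        then have "F \<in> chains_of r (below c)" using f(1)[OF cc(2)] by (auto simp: facets_def)
        then have "G \<in> chains_of r (below (m x))"
          using dom[OF cc(2)] F(2) unfolding chains_of_def Complete_Partial_Order.chain_def by blast
        then show "G \<in> B \<and> (insert c G \<in> B \<longleftrightarrow> G \<in> {})"
          using Cons.prems(3,4) by auto
      qed auto
      moreover have "shelling_over (B \<union> (\<Union>E\<in>set (map (insert c) (f c)). Pow E))
          (concat (map (\<lambda>c. map (insert c) (f c)) ds))"
      proof (rule Cons.IH)
        fix d G assume d: "d \<in> set ds" "G \<in> B \<union> (\<Union>E\<in>set (map (insert c) (f c)). Pow E)"
        have "d \<noteq> c" using d(1) Cons.prems(2) by auto
        moreover have "d \<notin> below c"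
          using d(1) Cons.prems(1) cc by (auto simp: coatoms_def)
        ultimately show "d \<notin> G" using d Cons.prems(4) sub by fastforce
      qed (use Cons.prems in auto)
      ultimately show ?case by (simp add: shelling_over_append)
    qed simp
    let ?Fs = "map (insert (m x)) (f (m x)) @ concat (map (\<lambda>c. map (insert c) (f c)) cs)"
    let ?B = "\<Union>E\<in>set (map (insert (m x)) (f (m x))). Pow E"
    have "shelling_over ?B (concat (map (\<lambda>c. map (insert c) (f c)) cs))"
    proof (rule other)
      show "chains_of r (below (m x)) \<subseteq> ?B"
      proof
        fix C assume C: "C \<in> chains_of r (below (m x))"
        have "finite (chains_of r (below (m x)))"
          using finite_below[of "m x"]
          by (auto simp: chains_of_def intro: finite_subset[of _ "Pow (below (m x))"])
        then obtain F where "F \<in> facets (chains_of r (below (m x)))" "C \<subseteq> F"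
          using face_in_facet C by blast
        then show "C \<in> ?B" using f(1)[OF mx] by auto
      qed
      fix c G assume c: "c \<in> set cs" "G \<in> ?B"
      then have "c \<noteq> m x" "c \<notin> below (m x)" using cs(1) mx by (auto simp: coatoms_def)
      moreover have "G \<subseteq> insert (m x) (below (m x))"
        using c(2) f(1)[OF mx] by (fastforce simp: facets_def chains_of_def)
      ultimately show "c \<notin> G" by auto
    qed (use cs in auto)
    then have "shelling_over {} ?Fs"
      using first by (simp add: shelling_over_append)
    moreover have "set ?Fs = facets (chains_of r (below x))"
    proof -
      have "set ?Fs = (\<Union>c\<in>insert (m x) (set cs). insert c ` set (f c))" by auto
      also have "insert (m x) (set cs) = coatoms x" using mc cs(1) by auto
      also have "(\<Union>c\<in>coatoms x. insert c ` set (f c)) = facets (chains_of r (below x))"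
        using f(1) unfolding facets_below[OF False] by (auto simp: coatoms_def)
      finally show ?thesis .
    qed
    ultimately show ?thesis by blast
  qed
qed

end

section \<open>Collapses along intervals of faces\<close>

text \<open>The new faces form the interval from \<open>R\<close> to \<open>F\<close> in the face lattice. Removing or adding the vertex \<open>v\<close>
  matches them in pairs, so that \<open>L \<union> Pow F\<close> collapses onto \<open>L\<close>. The construction starts with the void complex, to
  which a full simplex is added with \<open>R = {}\<close>; this is a collapse in the augmented sense, as the
  empty face is matched with the vertex \<open>{v}\<close>.\<close>

inductive interval_collapsible :: "'a set set \<Rightarrow> bool" where
  void: "interval_collapsible {}"
| expand: "interval_collapsible (L \<union> Pow F)"
  if "interval_collapsible L" "finite F" "R \<subseteq> F" "v \<in> F" "v \<notin> R"
    "\<And>G. G \<subseteq> F \<Longrightarrow> G \<in> L \<longleftrightarrow> \<not> R \<subseteq> G"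

lemma interval_collapsible_subset_closed:
  "interval_collapsible L \<Longrightarrow> G \<in> L \<Longrightarrow> H \<subseteq> G \<Longrightarrow> H \<in> L"
  by (induction arbitrary: G H rule: interval_collapsible.induct) blast+

lemma interval_collapsible_vertex:
  assumes "interval_collapsible L" "L \<noteq> {}"
  obtains v where "{v} \<in> L"
  using assms by cases auto

text \<open>The set \<open>H\<close> collects the facets with \<open>R = F\<close>. They can be withheld from \<open>L\<close>, since a facet is not
  contained in any other one: for a later facet, the old faces in \<open>L\<close> and in \<open>L \<union> H\<close> are the same.\<close>

lemma shelling_over_collapsible:
  assumes "shelling_over (L \<union> H) Fs" "interval_collapsible L" "L \<inter> H = {}"
    and "\<And>F. F \<in> set Fs \<Longrightarrow> finite F"
    and "\<And>E F. E \<in> H \<Longrightarrow> F \<in> set Fs \<Longrightarrow> \<not> E \<subseteq> F"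
    and "\<And>E F. E \<in> set Fs \<Longrightarrow> F \<in> set Fs \<Longrightarrow> E \<subseteq> F \<Longrightarrow> E = F"
  shows "\<exists>L' H'. L \<union> H \<union> (\<Union>F\<in>set Fs. Pow F) = L' \<union> H' \<and> L' \<inter> H' = {} \<and>
    H' \<subseteq> H \<union> set Fs \<and> interval_collapsible L'"
  using assms
proof (induction Fs arbitrary: L H)
  case Nil
  then show ?case by auto
next
  case (Cons F Fs)
  obtain R where R: "R \<subseteq> F" "\<And>G. G \<subseteq> F \<Longrightarrow> G \<in> L \<union> H \<longleftrightarrow> \<not> R \<subseteq> G"
    using Cons.prems(1) by auto
  have rest: "shelling_over (L \<union> H \<union> Pow F) Fs" using Cons.prems(1) by simp
  have inL: "G \<in> L \<longleftrightarrow> \<not> R \<subseteq> G" if "G \<subseteq> F" for G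
    using R(2)[OF that] Cons.prems(5)[of G F] that by auto
  have FF: "F \<notin> set Fs" using shelling_over_new[OF rest] by auto
  show ?case
  proof (cases "R = F")
    case True
    have "insert F (L \<union> H) = L \<union> H \<union> Pow F" using R True by blast
    moreover have "F \<notin> L" using inL[of F] True by simp
    moreover have noF: "\<not> F \<subseteq> E" if "E \<in> set Fs" for E
      using Cons.prems(6)[of F E] FF that by auto
    ultimately have "\<exists>L' H'. L \<union> insert F H \<union> (\<Union>F\<in>set Fs. Pow F) = L' \<union> H' \<and> L' \<inter> H' = {} \<and>
        H' \<subseteq> insert F H \<union> set Fs \<and> interval_collapsible L'"
      using rest Cons.prems(2-) noF by (intro Cons.IH) (auto simp: Un_assoc)
    moreover have "L \<union> insert F H \<union> (\<Union>F\<in>set Fs. Pow F) = L \<union> H \<union> (\<Union>F\<in>set (F # Fs). Pow F)"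
      using \<open>insert F (L \<union> H) = _\<close> by auto
    ultimately show ?thesis by auto
  next
    case False
    then obtain v where v: "v \<in> F" "v \<notin> R" using R(1) by blast
    have "interval_collapsible (L \<union> Pow F)"
      using expand[OF Cons.prems(2) _ R(1) v inL] Cons.prems(4) by simp
    then have "\<exists>L' H'. L \<union> Pow F \<union> H \<union> (\<Union>F\<in>set Fs. Pow F) = L' \<union> H' \<and> L' \<inter> H' = {} \<and>
        H' \<subseteq> H \<union> set Fs \<and> interval_collapsible L'"
      using rest Cons.prems(2-) by (intro Cons.IH) (auto simp: Un_ac)
    moreover have "L \<union> Pow F \<union> H \<union> (\<Union>F\<in>set Fs. Pow F) = L \<union> H \<union> (\<Union>F\<in>set (F # Fs). Pow F)"
      by auto
    moreover have "H \<union> set Fs \<subseteq> H \<union> set (F # Fs)" by auto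
    ultimately show ?thesis by (metis subset_trans)
  qed
qed

lemma facets_eqI: "E \<in> facets K \<Longrightarrow> F \<in> K \<Longrightarrow> E \<subseteq> F \<Longrightarrow> E = F"
  by (auto simp: facets_def)

theorem shellable_decomposition:
  assumes "shellable K"
  obtains L H where "K = L \<union> H" "L \<inter> H = {}" "H \<subseteq> facets K" "interval_collapsible L"
proof -
  have K: "finite_complex K" using assms by (simp add: shellable_def)
  obtain Fs where Fs: "set Fs = facets K" "shelling_over {} Fs"
    using assms shellable_iff[OF K] by blast
  have "\<exists>L H. {} \<union> {} \<union> (\<Union>F\<in>set Fs. Pow F) = L \<union> H \<and> L \<inter> H = {} \<and>
      H \<subseteq> {} \<union> set Fs \<and> interval_collapsible L"
    using Fs K void facets_eqI[of _ K]
    by (intro shelling_over_collapsible) (auto simp: finite_complex_def facets_def)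
  moreover have "(\<Union>F\<in>set Fs. Pow F) = K"
  proof -
    have "finite K" using K by (simp add: finite_complex_def)
    then show ?thesis using K unfolding Fs(1)
      by (auto simp: finite_complex_def facets_def elim: face_in_facet[unfolded facets_def])
  qed
  ultimately show ?thesis using that Fs(1) by auto
qed

section \<open>Reduced homology\<close>

lemma oriented_chains_mono: "L \<subseteq> K \<Longrightarrow> c \<in> oriented_chains L k \<Longrightarrow> c \<in> oriented_chains K k"
  unfolding oriented_chains_def by blast

lemma oriented_chains_support:
  assumes "c \<in> oriented_chains L k" "c vs \<noteq> 0"
  shows "distinct vs" "set vs \<in> L" "face_dim (set vs) = k"
  using assms unfolding oriented_chains_def by blast+

lemma oriented_boundary_subcomplex:
  assumes "finite (\<Union>K)" "L \<subseteq> K" "c \<in> oriented_chains L k"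
  shows "oriented_boundary K c = oriented_boundary L c"
proof
  fix vs
  have "c (v # vs) = 0" if "v \<notin> \<Union>L" for v
    using that oriented_chains_support(2)[OF assms(3), of "v # vs"] by auto
  then show "oriented_boundary K c vs = oriented_boundary L c vs"
    unfolding oriented_boundary_def using assms(1,2)
    by (intro sum.mono_neutral_right) auto
qed

lemma oriented_chains_move_front:
  assumes "c \<in> oriented_chains L k" "c (v # xs @ ys) = 0"
  shows "c (xs @ v # ys) = 0"
  using assms(2)
proof (induction xs arbitrary: ys rule: rev_induct)
  case (snoc x xs)
  have "c (xs @ v # x # ys) = 0" using snoc.IH[of "x # ys"] snoc.prems by simp
  then show ?case using oriented_chains_swap[OF assms(1), of xs x v ys] by simp
qed simp

text \<open>Working with the boundary operator of the ambient complex \<open>K\<close> throughout avoids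
  changing it in every step of a filtration.\<close>

definition acyclic_subcomplex :: "'a set set \<Rightarrow> 'a set set \<Rightarrow> bool" where
  "acyclic_subcomplex K L \<longleftrightarrow> (\<forall>k. \<forall>z\<in>oriented_chains L k. oriented_boundary K z = (\<lambda>vs. 0) \<longrightarrow>
     (\<exists>d\<in>oriented_chains L (k + 1). oriented_boundary K d = z))"

text \<open>The chain \<open>e\<close> is the cone with apex \<open>v\<close> over \<open>z\<close>, restricted to the faces satisfying \<open>S\<close>: it takes
  the value \<open>z us\<close> on \<open>v # us\<close>, and moving \<open>v\<close> back to its place in a list costs one sign per step.\<close>

lemma prism_in_chains:
  assumes z: "z \<in> oriented_chains K k" and v: "\<And>G. S G \<Longrightarrow> v \<in> G" and S: "\<And>G. S G \<Longrightarrow> G \<in> K"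
  defines "e \<equiv> \<lambda>us. if distinct us \<and> S (set us)
    then (-1) ^ length (takeWhile (\<lambda>u. u \<noteq> v) us) * z (remove1 v us) else 0"
  shows "e \<in> oriented_chains K (k + 1)"
proof -
  have "distinct us \<and> set us \<in> K \<and> face_dim (set us) = k + 1" if "e us \<noteq> 0" for us
  proof -
    have us: "distinct us" "S (set us)" "z (remove1 v us) \<noteq> 0"
      using that by (auto simp: e_def split: if_splits)
    have "face_dim (set us - {v}) = k"
      using oriented_chains_support(3)[OF z us(3)] us(1) by simp
    moreover have "card (set us - {v}) = card (set us) - 1" "0 < card (set us)"
      using v[OF us(2)] by (auto simp: card_gt_0_iff)
    ultimately show ?thesis using us S by (auto simp: face_dim_def of_nat_diff)
  qed
  moreover have "e (xs @ a # b # ys) = - e (xs @ b # a # ys)" for xs a b ys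
  proof (cases "distinct (xs @ a # b # ys) \<and> S (set (xs @ a # b # ys))")
    case True
    have *: "set (xs @ b # a # ys) = set (xs @ a # b # ys)" by auto
    have **: "distinct (xs @ b # a # ys)" "S (set (xs @ b # a # ys))"
      using True unfolding * by auto
    consider "v \<in> set xs" | "v \<notin> set xs" "v = a" "v \<noteq> b" | "v \<notin> set xs" "v = b" "v \<noteq> a"
      | "v \<notin> set xs" "v \<noteq> a" "v \<noteq> b"
      using True by auto
    moreover have tw: "takeWhile (\<lambda>u. u \<noteq> v) (xs @ zs) = xs @ takeWhile (\<lambda>u. u \<noteq> v) zs"
      if "v \<notin> set xs" for zs
      using that by (intro takeWhile_append2) auto
    ultimately show ?thesis
    proof cases
      case 1
      then show ?thesis
        using True ** oriented_chains_swap[OF z, of "remove1 v xs" a b ys]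
        by (auto simp: e_def remove1_append)
    next
      case 4
      then show ?thesis
        using tw True ** oriented_chains_swap[OF z, of xs a b "remove1 v ys"]
        by (simp add: e_def remove1_append)
    qed (use tw True ** in \<open>simp_all add: e_def remove1_append\<close>)
  next
    case False
    have zero: "e us = 0" if "\<not> (distinct us \<and> S (set us))" for us
      using that unfolding e_def by (rule if_not_P)
    have "set (xs @ b # a # ys) = set (xs @ a # b # ys)" by auto
    moreover have "distinct (xs @ b # a # ys) \<longleftrightarrow> distinct (xs @ a # b # ys)" by auto
    ultimately have swapped: "\<not> (distinct (xs @ b # a # ys) \<and> S (set (xs @ b # a # ys)))"
      using False by (simp only: not_False_eq_True)
    show ?thesis using zero[OF swapped] zero[OF False] by simp
  qed
  ultimately show ?thesis unfolding oriented_chains_def by blast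
qed

text \<open>Subtracting the boundary of a cone with apex \<open>v\<close> removes from a cycle all new faces that avoid \<open>v\<close>.
  A new face \<open>v # ws\<close> can then no longer occur either: in the boundary, its coefficient is the only
  contribution to \<open>ws\<close>. So every cycle is homologous to one of \<open>L\<close>.\<close>

lemma acyclic_expand:
  assumes K: "finite_complex K" and LF: "L \<union> Pow F \<subseteq> K"
    and L: "\<And>G H. G \<in> L \<Longrightarrow> H \<subseteq> G \<Longrightarrow> H \<in> L" "acyclic_subcomplex K L"
    and R: "R \<subseteq> F" "v \<in> F" "v \<notin> R" "\<And>G. G \<subseteq> F \<Longrightarrow> G \<in> L \<longleftrightarrow> \<not> R \<subseteq> G"
  shows "acyclic_subcomplex K (L \<union> Pow F)"
  unfolding acyclic_subcomplex_def
proof (intro allI ballI impI)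
  fix k z assume z: "z \<in> oriented_chains (L \<union> Pow F) k" and dz: "oriented_boundary K z = (\<lambda>vs. 0)"
  let ?M = "L \<union> Pow F"
  have fin: "finite (\<Union>K)" using K by (auto simp: finite_complex_def)
  have M: "finite_complex ?M"
    using K LF L(1) unfolding finite_complex_def by (auto intro: finite_subset)
  define e where "e = (\<lambda>us. if distinct us \<and> (v \<in> set us \<and> R \<subseteq> set us \<and> set us \<subseteq> F)
    then (-1) ^ length (takeWhile (\<lambda>u. u \<noteq> v) us) * z (remove1 v us) else 0)"
  have e: "e \<in> oriented_chains ?M (k + 1)"
    unfolding e_def
    by (rule prism_in_chains[where S = "\<lambda>G. v \<in> G \<and> R \<subseteq> G \<and> G \<subseteq> F", OF z]) auto
  have de: "oriented_boundary K e ws = z ws"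
    if "v \<notin> set ws" "R \<subseteq> set ws" "set ws \<subseteq> F" "distinct ws" for ws
  proof -
    have "e (u # ws) = (if u = v then z ws else 0)" for u
      using that R(1,2) by (auto simp: e_def)
    moreover have "v \<in> \<Union>K" using LF R(2) by blast
    ultimately show ?thesis using fin by (simp add: oriented_boundary_def)
  qed
  define y where "y = (\<lambda>vs. z vs + - oriented_boundary K e vs)"
  have dM: "oriented_boundary K e \<in> oriented_chains ?M k"
    using oriented_boundary_in_chains[OF M e] oriented_boundary_subcomplex[OF fin LF e] by simp
  have y: "y \<in> oriented_chains ?M k"
    unfolding y_def by (intro oriented_chains_add oriented_chains_uminus z dM)
  have dy: "oriented_boundary K y = (\<lambda>vs. 0)"
    unfolding y_def oriented_boundary_add oriented_boundary_uminus dz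
      oriented_boundary_boundary[OF oriented_chains_mono[OF LF e]] by simp
  have y0: "y ws = 0" if "v \<notin> set ws" "R \<subseteq> set ws" "set ws \<subseteq> F" for ws
  proof (cases "distinct ws")
    case True
    then show ?thesis using de[OF that] by (simp add: y_def)
  qed (use oriented_chains_support(1)[OF y, of ws] in blast)
  \<comment> \<open>The coefficient of the boundary of y at ws is y (v # ws), because any other coface of ws
    is a new face that avoids v.\<close>
  have y1: "y (v # ws) = 0" if ws: "R \<subseteq> set ws" "set ws \<subseteq> F" "v \<notin> set ws" for ws
  proof -
    have "y (u # ws) = 0" if "u \<noteq> v" for u
    proof (rule ccontr)
      assume nz: "y (u # ws) \<noteq> 0"
      have "set ws \<notin> L" using R(4) ws by blast
      then have "set (u # ws) \<notin> L" using L(1)[of "set (u # ws)" "set ws"] by auto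
      then have "set (u # ws) \<subseteq> F" using oriented_chains_support(2)[OF y nz] by auto
      then show False using y0[of "u # ws"] ws that nz by auto
    qed
    then have "oriented_boundary K y ws = (\<Sum>u\<in>\<Union>K. if u = v then y (v # ws) else 0)"
      unfolding oriented_boundary_def by (intro sum.cong) auto
    moreover have "v \<in> \<Union>K" using LF R(2) by blast
    ultimately show ?thesis using dy fin by simp
  qed
  have "set vs \<in> L" if nz: "y vs \<noteq> 0" for vs
  proof (rule ccontr)
    assume "set vs \<notin> L"
    then have vs: "set vs \<subseteq> F" "R \<subseteq> set vs" "distinct vs"
      using oriented_chains_support[OF y nz] R(4) by auto
    have "v \<in> set vs" using y0[of vs] vs nz by blast
    then obtain xs ys where xy: "vs = xs @ v # ys" by (auto simp: in_set_conv_decomp)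
    have "y (v # xs @ ys) = 0" using vs R(3) by (intro y1) (auto simp: xy)
    then show False using oriented_chains_move_front[OF y] nz xy by blast
  qed
  then have "y \<in> oriented_chains L k" using y unfolding oriented_chains_def by blast
  then obtain d where d: "d \<in> oriented_chains L (k + 1)" "oriented_boundary K d = y"
    using L(2) dy unfolding acyclic_subcomplex_def by blast
  have "(\<lambda>vs. d vs + e vs) \<in> oriented_chains ?M (k + 1)"
    using d(1) e by (intro oriented_chains_add) (auto intro: oriented_chains_mono[of L])
  moreover have "oriented_boundary K (\<lambda>vs. d vs + e vs) = z"
    unfolding oriented_boundary_add d(2) by (auto simp: y_def)
  ultimately show "\<exists>d\<in>oriented_chains ?M (k + 1). oriented_boundary K d = z" by blast
qed

lemma interval_collapsible_acyclic:
  assumes "interval_collapsible L" "finite_complex K" "L \<subseteq> K"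
  shows "acyclic_subcomplex K L"
  using assms
proof (induction rule: interval_collapsible.induct)
  case void
  have "z = (\<lambda>vs. 0)" if "z \<in> oriented_chains {} k" for z k
    using oriented_chains_support(2)[OF that] by blast
  then show ?case
    using oriented_chains_zero oriented_boundary_zero by (fastforce simp: acyclic_subcomplex_def)
next
  case (expand L F R v)
  then show ?case
    using interval_collapsible_subset_closed[OF expand.hyps(1)]
    by (intro acyclic_expand[of K L F R v]) auto
qed

definition cycle_group :: "'a set set \<Rightarrow> int \<Rightarrow> ('a list \<Rightarrow> int) monoid" where
  "cycle_group K k = (oriented_chain_group K k)\<lparr>carrier := oriented_cycles K k\<rparr>"

lemma cycle_group_simps [simp]:
  "carrier (cycle_group K k) = oriented_cycles K k"
  "c \<otimes>\<^bsub>cycle_group K k\<^esub> d = (\<lambda>vs. c vs + d vs)"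
  "\<one>\<^bsub>cycle_group K k\<^esub> = (\<lambda>vs. 0)"
  by (simp_all add: cycle_group_def oriented_chain_group_def)

lemma comm_group_cycle_group: "comm_group (cycle_group K k)"
proof (rule comm_groupI)
  fix c assume "c \<in> carrier (cycle_group K k)"
  then show "\<exists>d\<in>carrier (cycle_group K k). d \<otimes>\<^bsub>cycle_group K k\<^esub> c = \<one>\<^bsub>cycle_group K k\<^esub>"
    by (intro bexI[of _ "\<lambda>vs. - c vs"])
      (auto simp: oriented_cycles_def oriented_chains_uminus oriented_boundary_uminus)
qed (simp_all add: oriented_cycles_def oriented_chains_zero
    oriented_chains_add oriented_boundary_add oriented_boundary_zero ac_simps)

lemma cycle_group_pow: "z [^]\<^bsub>cycle_group K k\<^esub> (m::nat) = (\<lambda>vs. int m * z vs)"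
proof -
  interpret comm_group "cycle_group K k" by (rule comm_group_cycle_group)
  show ?thesis by (induction m) (simp_all add: nat_pow_Suc algebra_simps)
qed

lemma subgroup_boundaries:
  assumes K: "finite_complex K"
  shows "subgroup (oriented_boundaries K k) (cycle_group K k)"
proof -
  interpret Z: comm_group "cycle_group K k" by (rule comm_group_cycle_group)
  have sub: "oriented_boundaries K k \<subseteq> oriented_cycles K k"
    using oriented_boundary_in_chains[OF K] oriented_boundary_boundary
    by (auto simp: oriented_boundaries_def oriented_cycles_def)
  show ?thesis
  proof (rule Z.subgroupI)
    show "oriented_boundaries K k \<noteq> {}"
      using oriented_chains_zero by (auto simp: oriented_boundaries_def)
  next
    fix b assume b: "b \<in> oriented_boundaries K k"
    then obtain c where c: "c \<in> oriented_chains K (k + 1)" "b = oriented_boundary K c"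
      by (auto simp: oriented_boundaries_def)
    have nb: "(\<lambda>vs. - b vs) \<in> oriented_boundaries K k"
      using c oriented_chains_uminus[OF c(1)] oriented_boundary_uminus[of K c]
      unfolding oriented_boundaries_def by (metis image_eqI)
    have "inv\<^bsub>cycle_group K k\<^esub> b = (\<lambda>vs. - b vs)"
      by (rule Z.inv_equality) (use sub b nb in auto)
    with nb show "inv\<^bsub>cycle_group K k\<^esub> b \<in> oriented_boundaries K k" by simp
  next
    fix b b' assume "b \<in> oriented_boundaries K k" "b' \<in> oriented_boundaries K k"
    then obtain c c' where "c \<in> oriented_chains K (k + 1)" "b = oriented_boundary K c"
      "c' \<in> oriented_chains K (k + 1)" "b' = oriented_boundary K c'"
      by (auto simp: oriented_boundaries_def)
    then show "b \<otimes>\<^bsub>cycle_group K k\<^esub> b' \<in> oriented_boundaries K k"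
      using oriented_boundary_add[of K c c'] oriented_chains_add[of c K "k + 1" c']
      unfolding oriented_boundaries_def
      by (auto intro!: image_eqI[of _ _ "\<lambda>vs. c vs + c' vs"])
  qed (use sub in simp)
qed

lemma torsion_free_homologyI:
  assumes K: "finite_complex K"
    and *: "\<And>z m. z \<in> oriented_cycles K k \<Longrightarrow> 0 < m \<Longrightarrow>
      (\<lambda>vs. int m * z vs) \<in> oriented_boundaries K k \<Longrightarrow> z \<in> oriented_boundaries K k"
  shows "torsion_free_group (reduced_simplicial_homology K k)"
proof -
  let ?Z = "cycle_group K k" and ?B = "oriented_boundaries K k"
  interpret Z: comm_group ?Z by (rule comm_group_cycle_group)
  have sub: "subgroup ?B ?Z" by (rule subgroup_boundaries[OF K])
  then interpret N: normal ?B ?Z by (rule Z.subgroup_imp_normal)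
  have hom: "reduced_simplicial_homology K k = ?Z Mod ?B"
    by (simp add: reduced_simplicial_homology_def cycle_group_def)
  show ?thesis
    unfolding torsion_free_group_def hom
  proof (intro ballI allI impI)
    fix x and m :: nat
    assume x: "x \<in> carrier (?Z Mod ?B)" and m: "0 < m \<and> x [^]\<^bsub>?Z Mod ?B\<^esub> m = \<one>\<^bsub>?Z Mod ?B\<^esub>"
    obtain z where z: "z \<in> carrier ?Z" "x = ?B #>\<^bsub>?Z\<^esub> z"
      using x by (auto simp: FactGroup_def RCOSETS_def)
    have "?B #>\<^bsub>?Z\<^esub> (z [^]\<^bsub>?Z\<^esub> m) = ?B"
      using m N.FactGroup_pow[OF z(1), of m] z(2) by (simp add: FactGroup_def)
    then have "z [^]\<^bsub>?Z\<^esub> m \<in> ?B"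
      by (rule Z.coset_join1[OF _ Z.nat_pow_closed[OF z(1)] sub])
    then have "z \<in> ?B"
      using *[of z m] z(1) m by (simp add: cycle_group_pow)
    then show "x = \<one>\<^bsub>?Z Mod ?B\<^esub>"
      using Z.coset_join2[OF z(1) sub] z(2) by (simp add: FactGroup_def)
  qed
qed

text \<open>A facet is not a proper face of any simplex, so boundaries vanish on facets. A cycle with a positive
  multiple that is a boundary therefore lives on \<open>L\<close>.\<close>

theorem shellable_torsion_free_homology:
  assumes "shellable K"
  shows "torsion_free_group (reduced_simplicial_homology K k)"
proof -
  have K: "finite_complex K" using assms by (simp add: shellable_def)
  have fin: "finite (\<Union>K)" using K by (auto simp: finite_complex_def)
  obtain L H where LH: "K = L \<union> H" "L \<inter> H = {}" "H \<subseteq> facets K" "interval_collapsible L"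
    using shellable_decomposition[OF assms] by blast
  have acyc: "acyclic_subcomplex K L"
    using interval_collapsible_acyclic[OF LH(4) K] LH(1) by blast
  show ?thesis
  proof (rule torsion_free_homologyI[OF K])
    fix z and m :: nat
    assume z: "z \<in> oriented_cycles K k" and "0 < m"
      and mz: "(\<lambda>vs. int m * z vs) \<in> oriented_boundaries K k"
    have zK: "z \<in> oriented_chains K k" and dz: "oriented_boundary K z = (\<lambda>vs. 0)"
      using z by (auto simp: oriented_cycles_def)
    obtain c where c: "c \<in> oriented_chains K (k + 1)" "oriented_boundary K c = (\<lambda>vs. int m * z vs)"
      using mz by (auto simp: oriented_boundaries_def)
    have "set vs \<in> L" if nz: "z vs \<noteq> 0" for vs
    proof (rule ccontr)
      assume "set vs \<notin> L"
      then have facet: "set vs \<in> facets K"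
        using oriented_chains_support(2)[OF zK nz] LH(1,3) by blast
      \<comment> \<open>A nonzero coefficient would give a simplex of K that properly contains the facet.\<close>
      have "c (v # vs) = 0" for v
      proof (rule ccontr)
        assume "c (v # vs) \<noteq> 0"
        note s = oriented_chains_support[OF c(1) this]
        have "set vs = set (v # vs)" by (rule facets_eqI[OF facet s(2)]) auto
        then show False using s(1) by auto
      qed
      then have "oriented_boundary K c vs = 0" by (simp add: oriented_boundary_def)
      then show False using c(2) nz \<open>0 < m\<close> by simp
    qed
    then have "z \<in> oriented_chains L k" using zK unfolding oriented_chains_def by blast
    then obtain d where "d \<in> oriented_chains L (k + 1)" "oriented_boundary K d = z"
      using acyc dz unfolding acyclic_subcomplex_def by blast
    then show "z \<in> oriented_boundaries K k"
      using oriented_chains_mono[of L K] LH(1) unfolding oriented_boundaries_def by blast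
  qed
qed

section \<open>Contractibility of realizations\<close>

definition support :: "('a \<Rightarrow> real) \<Rightarrow> 'a set" where
  "support x = {v. x v \<noteq> 0}"

definition realization_space :: "'a set set \<Rightarrow> ('a \<Rightarrow> real) set" where
  "realization_space K = {x. (\<forall>v. 0 \<le> x v) \<and> support x \<in> K \<and> sum x (support x) = 1}"

lemma realization_eq: "realization K = top_of_set (realization_space K)"
  by (simp add: realization_def realization_space_def support_def euclidean_product_topology)

lemma realization_space_iff:
  assumes "finite V" "\<Union>K \<subseteq> V"
  shows "x \<in> realization_space K \<longleftrightarrow> (\<forall>v. 0 \<le> x v) \<and> support x \<in> K \<and> sum x V = 1"
proof -
  have "sum x (support x) = sum x V" if "support x \<in> K"
    using that assms by (intro sum.mono_neutral_left) (auto simp: support_def)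
  then show ?thesis by (auto simp: realization_space_def)
qed

lemma realization_space_mono: "L \<subseteq> K \<Longrightarrow> realization_space L \<subseteq> realization_space K"
  by (auto simp: realization_space_def)

lemma realization_space_Pow:
  assumes "finite F"
  shows "realization_space (Pow F) = {x. (\<forall>v. 0 \<le> x v) \<and> (\<forall>v. v \<in> F \<or> x v = 0) \<and> sum x F = 1}"
  using realization_space_iff[of F "Pow F"] assms by (auto simp: support_def)

lemma continuous_on_coordinate: "continuous_on S (\<lambda>x :: 'a \<Rightarrow> real. x i)"
  by (rule continuous_on_subset[OF continuous_on_product_coordinates]) simp

lemma realization_space_vertex:
  assumes "{v} \<in> K"
  shows "(\<lambda>w. if w = v then 1 else 0) \<in> realization_space K"
proof -
  have "support (\<lambda>w. if w = v then 1 else 0) = {v}" by (auto simp: support_def)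
  then show ?thesis using assms by (simp add: realization_space_def)
qed

lemma closed_simplex:
  assumes "finite F"
  shows "closed (realization_space (Pow F))"
proof -
  have "realization_space (Pow F) =
      (\<Inter>v. {x. 0 \<le> x v}) \<inter> (\<Inter>v\<in>-F. {x. x v = 0}) \<inter> {x. sum x F = 1}"
    unfolding realization_space_Pow[OF assms] by auto
  moreover have "closed {x :: 'a \<Rightarrow> real. 0 \<le> x v}" "closed {x :: 'a \<Rightarrow> real. x v = 0}" for v
    by (intro closed_Collect_le closed_Collect_eq continuous_on_coordinate continuous_on_const)+
  moreover have "closed {x :: 'a \<Rightarrow> real. sum x F = 1}"
    by (intro closed_Collect_eq continuous_on_sum continuous_on_coordinate continuous_on_const)
  ultimately show ?thesis by (auto intro!: closed_Int closed_INT)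
qed

text \<open>Tychonoff's theorem: the realizations are subsets of this cube.\<close>

lemma compact_unit_cube: "compact (Pi UNIV (\<lambda>v. {0..1}) :: ('a \<Rightarrow> real) set)"
proof -
  have "compactin (powertop_real UNIV) (PiE UNIV (\<lambda>v::'a. {0..1::real}))"
    unfolding compactin_PiE by simp
  then show ?thesis by (simp add: euclidean_product_topology PiE_UNIV_domain)
qed

lemma compact_simplex:
  assumes "finite F"
  shows "compact (realization_space (Pow F))"
proof -
  have "x v \<le> 1" if x: "x \<in> realization_space (Pow F)" for x v
  proof (cases "v \<in> F")
    case True
    then have "x v \<le> sum x F"
      using x assms by (intro member_le_sum) (auto simp: realization_space_Pow)
    then show ?thesis using x assms by (simp add: realization_space_Pow)
  next
    case False
    then have "x v = 0" using x assms by (auto simp: realization_space_Pow)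
    then show ?thesis by simp
  qed
  then have "realization_space (Pow F) = Pi UNIV (\<lambda>v. {0..1}) \<inter> realization_space (Pow F)"
    by (auto simp: realization_space_def)
  then show ?thesis
    using compact_Int_closed[OF compact_unit_cube closed_simplex[OF assms]] by simp
qed

lemma realization_space_eq_Union:
  assumes "finite_complex K"
  shows "realization_space K = (\<Union>F\<in>K. realization_space (Pow F))"
proof
  show "realization_space K \<subseteq> (\<Union>F\<in>K. realization_space (Pow F))"
    by (auto simp: realization_space_def)
  show "(\<Union>F\<in>K. realization_space (Pow F)) \<subseteq> realization_space K"
    using assms realization_space_mono unfolding finite_complex_def by blast
qed

lemma closed_realization_space:
  assumes "finite_complex K"
  shows "closed (realization_space K)"
  unfolding realization_space_eq_Union[OF assms]
  using assms by (intro closed_UN closed_simplex ballI) (auto simp: finite_complex_def)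

lemma continuous_on_Min_image:
  fixes f :: "'i \<Rightarrow> 'a::topological_space \<Rightarrow> real"
  assumes "finite I" "I \<noteq> {}" "\<And>i. i \<in> I \<Longrightarrow> continuous_on S (f i)"
  shows "continuous_on S (\<lambda>x. Min ((\<lambda>i. f i x) ` I))"
  using assms
proof (induction I rule: finite_ne_induct)
  case (insert i I)
  then have "continuous_on S (\<lambda>x. min (f i x) (Min ((\<lambda>i. f i x) ` I)))"
    by (intro continuous_intros) auto
  then show ?case using insert.hyps by simp
qed simp

lemma continuous_on_snd_coordinate:
  "continuous_on S (\<lambda>p :: 'b::topological_space \<times> ('a \<Rightarrow> real). snd p w)"
  by (rule continuous_on_compose2[OF continuous_on_coordinate[of UNIV] continuous_on_snd[OF continuous_on_id]]) simp

lemma homotopic_with_top_of_setI: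
  fixes h :: "real \<times> 'a::topological_space \<Rightarrow> 'a"
  assumes "continuous_on ({0..1} \<times> S) h"
    and "\<And>t x. t \<in> {0..1} \<Longrightarrow> x \<in> S \<Longrightarrow> h (t, x) \<in> S"
    and "\<And>x. x \<in> S \<Longrightarrow> h (0, x) = f x" "\<And>x. x \<in> S \<Longrightarrow> h (1, x) = g x"
    and "\<And>t. t \<in> {0..1} \<Longrightarrow> P (\<lambda>x. h (t, x))"
    and "\<And>h k. (\<And>x. x \<in> S \<Longrightarrow> h x = k x) \<Longrightarrow> P h \<longleftrightarrow> P k"
  shows "homotopic_with P (top_of_set S) (top_of_set S) f g"
proof (subst homotopic_with)
  show "\<exists>h. continuous_map (prod_topology (top_of_set {0..1::real}) (top_of_set S)) (top_of_set S) h \<and>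
      (\<forall>x\<in>topspace (top_of_set S). h (0, x) = f x) \<and> (\<forall>x\<in>topspace (top_of_set S). h (1, x) = g x) \<and>
      (\<forall>t\<in>{0..1}. P (\<lambda>x. h (t, x)))"
    using assms(1-5) by (intro exI[of _ h]) auto
next
  fix h k :: "'a \<Rightarrow> 'a"
  assume "\<And>x. x \<in> topspace (top_of_set S) \<Longrightarrow> h x = k x"
  then show "P h \<longleftrightarrow> P k" by (intro assms(6)) simp
qed

lemma contractible_simplex:
  assumes F: "finite F" "v \<in> F"
  shows "contractible_space (realization (Pow F))"
proof -
  let ?P = "realization_space (Pow F)" and ?p = "\<lambda>w. if w = v then 1 else 0 :: real"
  have "homotopic_with (\<lambda>f. True) (top_of_set ?P) (top_of_set ?P) id (\<lambda>x. ?p)"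
  proof (rule homotopic_with_top_of_setI[where h = "\<lambda>p w. (1 - fst p) * snd p w + fst p * ?p w"])
    show "continuous_on ({0..1} \<times> ?P) (\<lambda>p w. (1 - fst p) * snd p w + fst p * ?p w)"
      by (intro continuous_on_coordinatewise_then_product continuous_on_add continuous_on_mult
          continuous_on_diff continuous_on_const continuous_on_fst continuous_on_id
          continuous_on_snd_coordinate)
    fix t :: real and x assume t: "t \<in> {0..1}" and x: "x \<in> ?P"
    have "(\<Sum>w\<in>F. (1 - t) * x w + t * ?p w) = 1"
      using x F by (simp add: realization_space_Pow sum.distrib flip: sum_distrib_left)
    then show "(\<lambda>w. (1 - fst (t, x)) * snd (t, x) w + fst (t, x) * ?p w) \<in> ?P"
      using t x F by (auto simp: realization_space_Pow)
  qed auto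
  then show ?thesis by (auto simp: contractible_space_def realization_eq)
qed

text \<open>With \<open>\<mu>\<close> the least coordinate over \<open>R\<close>, the retraction subtracts \<open>\<mu>\<close> from each coordinate in \<open>R\<close> and adds
  the mass obtained to the coordinate of \<open>v\<close>. Afterwards some vertex of \<open>R\<close> is missing from the
  support, so the point lies in a face of \<open>L\<close>. On the realization of \<open>L\<close>, where \<open>R\<close> is never contained in the
  support, \<open>\<mu>\<close> is zero and nothing moves.\<close>

lemma contractible_expand:
  assumes fin: "finite_complex L" "finite F"
    and R: "R \<subseteq> F" "v \<in> F" "v \<notin> R" "\<And>G. G \<subseteq> F \<Longrightarrow> G \<in> L \<longleftrightarrow> \<not> R \<subseteq> G"
    and L: "contractible_space (realization L)"
  shows "contractible_space (realization (L \<union> Pow F))"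
proof -
  let ?M = "L \<union> Pow F"
  define V where "V = \<Union>?M"
  have V: "finite V" "\<Union>?M \<subseteq> V" "\<Union>L \<subseteq> V" "F \<subseteq> V"
    using fin by (auto simp: V_def finite_complex_def)
  have R0: "R \<noteq> {}" "finite R"
    using R(4)[of "{}"] fin finite_subset[OF R(1)] by (auto simp: finite_complex_def)
  define \<mu> :: "('a \<Rightarrow> real) \<Rightarrow> real" where "\<mu> x = Min (x ` R)" for x
  define h where "h = (\<lambda>p w. snd p w - fst p * \<mu> (snd p) * of_bool (w \<in> R)
      + fst p * card R * \<mu> (snd p) * of_bool (w = v))"
  have cont: "continuous_on S (\<lambda>x. \<mu> x)" for S
    unfolding \<mu>_def using continuous_on_Min_image[of R S "\<lambda>w x. x w"] R0 by (simp add: continuous_on_coordinate)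
  have \<mu>_le: "\<mu> x \<le> x w" if "w \<in> R" for x w
    using that R0 by (simp add: \<mu>_def)
  have \<mu>_pos: "0 \<le> \<mu> x" if "\<And>w. 0 \<le> x w" for x
    using that R0 by (simp add: \<mu>_def)
  have \<mu>_attained: "\<exists>w\<in>R. x w = \<mu> x" for x
  proof -
    have "\<mu> x \<in> x ` R" unfolding \<mu>_def using R0 by (intro Min_in) auto
    then show ?thesis by (metis imageE)
  qed
  have fixed: "h (t, x) = x" if x: "\<not> R \<subseteq> support x" "\<And>w. 0 \<le> x w" for t x
  proof -
    obtain w where "w \<in> R" "x w = 0" using x(1) by (auto simp: support_def)
    then have "\<mu> x = 0" using \<mu>_le[of w x] \<mu>_pos[of x, OF x(2)] by simp
    then show ?thesis by (auto simp: h_def)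
  qed
  have notR: "\<not> R \<subseteq> G" if "G \<in> L" for G
    using that R(1) R(4)[of R] fin(1) by (auto simp: finite_complex_def)
  have into: "h (t, x) \<in> realization_space ?M \<and> (t = 1 \<longrightarrow> h (t, x) \<in> realization_space L)"
    if t: "t \<in> {0..1}" and x: "x \<in> realization_space ?M" for t x
  proof (cases "R \<subseteq> support x")
    case False
    have pos: "0 \<le> x w" for w using x by (simp add: realization_space_def)
    have "support x \<in> L" using x False R(4) by (auto simp: realization_space_def)
    then show ?thesis using fixed[OF False pos] x by (auto simp: realization_space_def)
  next
    case True
    have x': "0 \<le> x w" "support x \<in> ?M" "sum x V = 1" for w
      using x V by (auto simp: realization_space_iff)
    then have sub: "support x \<subseteq> F" using notR True by blast
    have le: "t * \<mu> x \<le> \<mu> x" "0 \<le> t * \<mu> x"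
      using t \<mu>_pos[of x, OF x'(1)] by (auto intro: mult_left_le_one_le)
    define a b where "a = t * \<mu> x" and "b = t * card R * \<mu> x"
    have hx: "h (t, x) = (\<lambda>w. x w - a * of_bool (w \<in> R) + b * of_bool (w = v))"
      by (simp add: h_def a_def b_def)
    have b: "0 \<le> b" "b = a * card R" using t \<mu>_pos[of x, OF x'(1)] by (auto simp: a_def b_def)
    have pos: "0 \<le> h (t, x) w" for w
      using \<mu>_le[of w x] le x'(1)[of w] b(1) R(3) unfolding hx a_def[symmetric]
      by (cases "w \<in> R"; cases "w = v") auto
    have "h (t, x) w = 0" if w: "w \<notin> F" for w
      using w sub R(1,2) unfolding hx by (auto simp: support_def)
    then have supp: "support (h (t, x)) \<subseteq> F"
      by (auto simp: support_def)
    have "V \<inter> R = R" using R(1) V(4) by auto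
    then have "(\<Sum>w\<in>V. of_bool (w \<in> R)) = real (card R)"
      using V(1) by (simp add: of_bool_def sum.If_cases Int_def[symmetric])
    moreover have "(\<Sum>w\<in>V. of_bool (w = v)) = (1::real)"
      using V(1,4) R(2) by (auto simp: of_bool_def)
    ultimately have one: "sum (h (t, x)) V = 1"
      unfolding hx sum.distrib sum_subtractf sum_distrib_left[symmetric] using x'(3) b(2) by simp
    have "support (h (1, x)) \<in> L" if "t = 1"
    proof -
      obtain w where w: "w \<in> R" "x w = \<mu> x" using \<mu>_attained by blast
      then have "w \<notin> support (h (1, x))" using R(3) by (auto simp: support_def h_def)
      then show ?thesis using R(4) supp w that by blast
    qed
    then show ?thesis using V pos supp one by (auto simp: realization_space_iff)
  qed
  let ?r = "\<lambda>x. h (1, x)"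
  have cont_h: "continuous_on S h" for S
    unfolding h_def
    by (intro continuous_on_coordinatewise_then_product continuous_on_add continuous_on_mult
        continuous_on_diff continuous_on_const continuous_on_fst continuous_on_id
        continuous_on_snd_coordinate continuous_on_compose2[OF cont[of UNIV] continuous_on_snd]) auto
  have fixL: "h (t, x) = x" if "x \<in> realization_space L" for t x
    using that notR by (intro fixed) (auto simp: realization_space_def)
  have "homotopic_with (\<lambda>f. True) (top_of_set (realization_space ?M)) (top_of_set (realization_space ?M)) id ?r"
    by (rule homotopic_with_top_of_setI[OF cont_h]) (use into in \<open>auto simp: h_def\<close>)
  then have hom: "homotopic_with (\<lambda>f. True) (realization ?M) (realization ?M) ?r id"
    by (simp add: realization_eq homotopic_with_symD)
  moreover have "continuous_on S ?r" for S
    by (rule continuous_on_compose2[OF cont_h[of UNIV]])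
      (auto intro!: continuous_on_Pair continuous_on_const continuous_on_id)
  then have "retraction_maps (realization ?M) (realization L) ?r id"
    unfolding retraction_maps_def realization_eq
    using into[of 1] fixL realization_space_mono[of L ?M] by auto
  ultimately have "realization ?M homotopy_equivalent_space realization L"
    by (rule deformation_retract_imp_homotopy_equivalent_space)
  then show ?thesis using L homotopy_equivalent_space_contractibility by blast
qed

lemma interval_collapsible_contractible:
  assumes "interval_collapsible L" "L \<noteq> {}"
  shows "finite_complex L \<and> contractible_space (realization L)"
  using assms
proof (induction rule: interval_collapsible.induct)
  case (expand L F R v)
  show ?case
  proof (cases "L = {}")
    case True
    then show ?thesis
      using contractible_simplex[of F v] expand.hyps
      by (auto simp: finite_complex_def intro: finite_subset)
  next
    case False
    then have "finite_complex L" "contractible_space (realization L)"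
      using expand.IH by auto
    moreover from this have "finite_complex (L \<union> Pow F)"
      using expand.hyps(2) unfolding finite_complex_def by (auto intro: finite_subset)
    ultimately show ?thesis
      using contractible_expand[of L F R v] expand.hyps by blast
  qed
qed simp

section \<open>Quotients by contractible subcomplexes\<close>

text \<open>As \<open>k\<close> is constant on the fibres of \<open>q\<close>, it factors as \<open>g \<circ> q\<close>, and the given homotopy shows that
  \<open>g \<circ> q\<close> is homotopic to the identity. The homotopy maps fibres into fibres, so it descends to \<open>Y\<close>, because
  \<open>q\<close> times the identity of the compact interval is again a quotient map; it descends to a homotopy from the
  identity to \<open>q \<circ> g\<close>.\<close>

lemma quotient_homotopy_equivalence:
  assumes q: "quotient_map X Y q"
    and hom: "homotopic_with (\<lambda>f. \<forall>x\<in>topspace X. \<forall>y\<in>topspace X. q x = q y \<longrightarrow> q (f x) = q (f y)) X X id k"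
    and k: "\<And>x y. x \<in> topspace X \<Longrightarrow> y \<in> topspace X \<Longrightarrow> q x = q y \<Longrightarrow> k x = k y"
  shows "X homotopy_equivalent_space Y"
proof -
  let ?I = "top_of_set {0..1::real}"
  have cont_k: "continuous_map X X k"
    using homotopic_with_imp_continuous_maps[OF hom] by blast
  obtain g where g: "continuous_map Y X g" "g ` topspace Y = k ` topspace X"
      "\<And>x. x \<in> topspace X \<Longrightarrow> g (q x) = k x"
    by (rule quotient_map_lift_exists[OF q cont_k]) (use k in blast)+
  obtain h where h: "continuous_map (prod_topology ?I X) X h" "\<forall>x. h (0, x) = id x" "\<forall>x. h (1, x) = k x"
    and fib: "\<forall>t\<in>{0..1}. \<forall>x\<in>topspace X. \<forall>y\<in>topspace X. q x = q y \<longrightarrow> q (h (t, x)) = q (h (t, y))"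
    using hom unfolding homotopic_with_def by blast
  have onto: "q ` topspace X = topspace Y"
    using q by (rule quotient_imp_surjective_map)
  have qI: "quotient_map (prod_topology ?I X) (prod_topology ?I Y) (\<lambda>(t, x). (t, q x))"
  proof (rule quotient_map_prod_right[OF _ _ q])
    show "locally_compact_space ?I"
      by (intro compact_imp_locally_compact_space compact_space_subtopology)
        (simp add: compactin_euclidean_iff)
  qed (simp add: Hausdorff_space_subtopology)
  have qh: "continuous_map (prod_topology ?I X) Y (q \<circ> h)"
    using continuous_map_compose[OF h(1) quotient_imp_continuous_map[OF q]] .
  have fibres: "(q \<circ> h) u = (q \<circ> h) w"
    if uw: "u \<in> topspace (prod_topology ?I X)" "w \<in> topspace (prod_topology ?I X)"
      "(\<lambda>(t, x). (t, q x)) u = (\<lambda>(t, x). (t, q x)) w" for u w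
  proof -
    obtain t x where u: "u = (t, x)" by (cases u)
    obtain y where w: "w = (t, y)" "q x = q y" using uw(3) u by (cases w) auto
    have "t \<in> {0..1}" "x \<in> topspace X" "y \<in> topspace X" using uw(1,2) u w(1) by auto
    then show ?thesis using fib w u by (metis comp_apply)
  qed
  obtain G where G: "continuous_map (prod_topology ?I Y) Y G"
      "G ` topspace (prod_topology ?I Y) = (q \<circ> h) ` topspace (prod_topology ?I X)"
      "\<And>u. u \<in> topspace (prod_topology ?I X) \<Longrightarrow> G ((\<lambda>(t, x). (t, q x)) u) = (q \<circ> h) u"
    by (rule quotient_map_lift_exists[OF qI qh]) (use fibres in blast)+
  have Gq: "G (t, q x) = q (h (t, x))" if "t \<in> {0..1}" "x \<in> topspace X" for t x
    using G(3)[of "(t, x)"] that by simp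
  have "homotopic_with (\<lambda>f. True) Y Y id (q \<circ> g)"
  proof (subst homotopic_with)
    have "G (0, y) = id y" "G (1, y) = (q \<circ> g) y" if y: "y \<in> topspace Y" for y
    proof -
      obtain x where x: "x \<in> topspace X" "y = q x" using onto y by blast
      show "G (0, y) = id y" "G (1, y) = (q \<circ> g) y"
        using Gq[of 0 x] Gq[of 1 x] x h(2,3) g(3)[OF x(1)] by simp_all
    qed
    then show "\<exists>h. continuous_map (prod_topology ?I Y) Y h \<and> (\<forall>x\<in>topspace Y. h (0, x) = id x) \<and>
        (\<forall>x\<in>topspace Y. h (1, x) = (q \<circ> g) x) \<and> (\<forall>t\<in>{0..1}. True)"
      using G(1) by blast
  qed simp
  moreover have "homotopic_with (\<lambda>f. True) X X id (g \<circ> q)"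
  proof (rule homotopic_with_eq)
    show "homotopic_with (\<lambda>f. True) X X id k"
      using hom by (rule homotopic_with_mono) simp
  qed (use g(3) in auto)
  ultimately show ?thesis
    unfolding homotopy_equivalent_space_def
    using g(1) quotient_imp_continuous_map[OF q]
    by (intro exI[of _ q] exI[of _ g] conjI) (auto intro: homotopic_with_symD)
qed

text \<open>This is the homotopy extension property of the pair \<open>(|K|, |L|)\<close>, applied to a contraction of \<open>|L|\<close>.
  The distance of \<open>x\<close> from \<open>|L|\<close> is measured by \<open>\<theta> x\<close>, the least mass outside a face of \<open>L\<close>.
  Cutting off \<open>\<theta> x\<close> from all coordinates and normalizing moves \<open>x\<close> into \<open>|L|\<close>, for a coordinate
  larger than \<open>\<theta> x\<close> belongs to the minimizing face. This is possible as long as \<open>\<theta> x\<close> is small, and is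
  damped by \<open>\<epsilon>\<close> farther away. After this first homotopy, the contraction of \<open>|L|\<close> can be run near \<open>|L|\<close>,
  for a time that decreases to zero at \<open>\<theta> x = \<epsilon>\<close>.\<close>

lemma deform_subcomplex_to_point:
  assumes K: "finite_complex K" and L: "L \<subseteq> K" "finite_complex L"
    and contr: "contractible_space (realization L)"
  shows "\<exists>k p. homotopic_with (\<lambda>f. f ` realization_space L \<subseteq> realization_space L) (realization K) (realization K) id k \<and>
    (\<forall>x\<in>realization_space L. k x = p)"
proof -
  let ?K = "realization_space K" and ?L = "realization_space L"
  let ?P = "\<lambda>f. f ` ?L \<subseteq> ?L"
  define V where "V = \<Union>K"
  have V: "finite V" "\<Union>K \<subseteq> V" using K by (auto simp: V_def finite_complex_def)
  have LK: "?L \<subseteq> ?K" using L(1) by (rule realization_space_mono)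
  have x: "0 \<le> x v" "support x \<in> K" "sum x V = 1" if "x \<in> ?K" for x v
    using that V by (auto simp: realization_space_iff)
  have Pext: "?P h \<longleftrightarrow> ?P k" if "\<And>x. x \<in> ?K \<Longrightarrow> h x = k x" for h k :: "('a \<Rightarrow> real) \<Rightarrow> 'a \<Rightarrow> real"
    using that LK by (intro arg_cong[of _ _ "\<lambda>A. A \<subseteq> ?L"] image_cong) auto
  \<comment> \<open>At most half of the total mass gets lost when eps is cut off from every coordinate.\<close>
  define \<epsilon> where "\<epsilon> = 1 / (2 * (real (card V) + 1))"
  have eps: "0 < \<epsilon>" "card V * \<epsilon> \<le> 1 / 2" by (auto simp: \<epsilon>_def field_simps)
  define \<theta> :: "('a \<Rightarrow> real) \<Rightarrow> real" where "\<theta> x = Min ((\<lambda>F. 1 - sum x F) ` L)" for x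
  have L0: "finite L" "L \<noteq> {}" using L(2) by (auto simp: finite_complex_def)
  have FV: "F \<subseteq> V" if "F \<in> L" for F using that L(1) by (auto simp: V_def)
  have sum_le: "sum x F \<le> 1" if "x \<in> ?K" "F \<in> L" for x F
    using sum_mono2[OF V(1) FV[OF that(2)], of x] x[OF that(1)] by auto
  have \<theta>_nonneg: "0 \<le> \<theta> x" if "x \<in> ?K" for x
    using L0 sum_le[OF that] by (simp add: \<theta>_def)
  have \<theta>_L: "\<theta> x = 0" if "x \<in> ?L" for x
  proof -
    have "support x \<in> L" "sum x (support x) = 1" using that by (auto simp: realization_space_def)
    then have "\<theta> x \<le> 0"
      unfolding \<theta>_def using L0 by (intro Min_le) (auto intro!: image_eqI[of _ _ "support x"])
    then show ?thesis using \<theta>_nonneg[of x] that LK by auto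
  qed
  have \<theta>_support: "{v. \<theta> x < x v} \<in> L" if xK: "x \<in> ?K" for x
  proof -
    have "\<theta> x \<in> (\<lambda>F. 1 - sum x F) ` L" unfolding \<theta>_def using L0 by (intro Min_in) auto
    then obtain F where F: "F \<in> L" "\<theta> x = 1 - sum x F" by blast
    have "x v \<le> \<theta> x" if "v \<notin> F" for v
    proof (cases "v \<in> V")
      case True
      have "sum x (insert v F) \<le> sum x V"
        using True FV[OF F(1)] V(1) x(1)[OF xK] by (intro sum_mono2) auto
      then show ?thesis
        using that finite_subset[OF FV[OF F(1)] V(1)] x(3)[OF xK] F(2) by simp
    next
      case False
      then have "x v = 0" using x(2)[OF xK] V(2) by (auto simp: support_def)
      then show ?thesis using \<theta>_nonneg[OF xK] by simp
    qed
    then have "{v. \<theta> x < x v} \<subseteq> F" by (auto simp: not_less[symmetric])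
    then show ?thesis using F(1) L(2) unfolding finite_complex_def by blast
  qed
  have cont_\<theta>: "continuous_on S \<theta>" for S
  proof -
    have "continuous_on S (\<lambda>x. Min ((\<lambda>F. 1 - sum x F) ` L))"
      using L0 by (intro continuous_on_Min_image continuous_on_diff continuous_on_const
          continuous_on_sum continuous_on_coordinate)
    then show ?thesis by (simp add: \<theta>_def[abs_def])
  qed
  define mass where "mass = (\<lambda>(c::real, x :: 'a \<Rightarrow> real). \<Sum>v\<in>V. max 0 (x v - c))"
  define trunc where "trunc = (\<lambda>(c::real, x :: 'a \<Rightarrow> real) v. max 0 (x v - c) / mass (c, x))"
  have mass: "0 < mass (c, x)" if "0 \<le> c" "c \<le> \<epsilon>" "x \<in> ?K" for c x
  proof -
    have "1 - card V * c = (\<Sum>v\<in>V. x v - c)" using x(3)[OF that(3)] by (simp add: sum_subtractf)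
    also have "\<dots> \<le> mass (c, x)" unfolding mass_def prod.case by (intro sum_mono) auto
    finally have "1 - card V * c \<le> mass (c, x)" .
    moreover have "card V * c \<le> card V * \<epsilon>" using that by (intro mult_left_mono) auto
    ultimately show ?thesis using eps(2) by linarith
  qed
  have trunc_in: "trunc (c, x) \<in> realization_space M"
    if c: "0 \<le> c" "c \<le> \<epsilon>" and xK: "x \<in> ?K" and M: "{v. c < x v} \<in> M" "M \<subseteq> K" for c x M
  proof -
    have "support (trunc (c, x)) = {v. c < x v}"
      using mass[OF c xK] by (auto simp: support_def trunc_def)
    moreover have "sum (trunc (c, x)) V = 1"
      using mass[OF c xK] by (simp add: trunc_def mass_def flip: sum_divide_distrib)
    moreover have "0 \<le> trunc (c, x) v" for v
      using mass[OF c xK] by (simp add: trunc_def)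
    moreover have "\<Union>M \<subseteq> V" using M(2) by (auto simp: V_def)
    ultimately show ?thesis using V(1) M(1) by (simp add: realization_space_iff)
  qed
  have trunc_K: "trunc (c, x) \<in> ?K" if c: "0 \<le> c" "c \<le> \<epsilon>" and xK: "x \<in> ?K" for c x
  proof (rule trunc_in[OF c xK])
    have "{v. c < x v} \<subseteq> support x" using c(1) by (auto simp: support_def)
    then show "{v. c < x v} \<in> K" using x(2)[OF xK] K unfolding finite_complex_def by blast
  qed simp
  have trunc_0: "trunc (0, x) = x" if "x \<in> ?K" for x
    using x[OF that] by (auto simp: trunc_def mass_def)
  have cont_trunc: "continuous_on ({0..\<epsilon>} \<times> ?K) trunc"
  proof -
    have 1: "continuous_on S (\<lambda>u::real \<times> ('a \<Rightarrow> real). max 0 (snd u v - fst u))" for S v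
      by (intro continuous_on_max continuous_on_const continuous_on_diff continuous_on_snd_coordinate
          continuous_on_fst continuous_on_id)
    have "continuous_on S (\<lambda>u. mass u)" for S
      unfolding mass_def case_prod_beta by (intro continuous_on_sum 1)
    then have "continuous_on ({0..\<epsilon>} \<times> ?K) (\<lambda>u v. max 0 (snd u v - fst u) / mass u)"
      using mass by (intro continuous_on_coordinatewise_then_product continuous_on_divide 1) force+
    then show ?thesis by (simp add: trunc_def case_prod_beta')
  qed
  define c where "c x = min (\<theta> x) \<epsilon>" for x
  have c: "0 \<le> c x" "c x \<le> \<epsilon>" if "x \<in> ?K" for x
    using \<theta>_nonneg[OF that] eps(1) by (auto simp: c_def)
  have cont_c: "continuous_on S c" for S
    unfolding c_def[abs_def] by (intro continuous_on_min cont_\<theta> continuous_on_const)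
  define r where "r x = trunc (c x, x)" for x
  have r_K: "r x \<in> ?K" if "x \<in> ?K" for x
    unfolding r_def using trunc_K c that by blast
  have r_L: "r x \<in> ?L" if "x \<in> ?K" "\<theta> x \<le> \<epsilon>" for x
    unfolding r_def using trunc_in[OF c[OF that(1)] that(1), of L] \<theta>_support[OF that(1)] L(1) that(2)
    by (simp add: c_def)
  have r_id: "r x = x" if "x \<in> ?L" for x
    using \<theta>_L[OF that] trunc_0 that LK eps(1) by (auto simp: r_def c_def)
  have scale: "0 \<le> t * c x" "t * c x \<le> \<epsilon>" if "t \<in> {0..1}" "x \<in> ?K" for t x
  proof -
    show "0 \<le> t * c x" using that c by auto
    have "t * c x \<le> 1 * c x" using that c by (intro mult_right_mono) auto
    then show "t * c x \<le> \<epsilon>" using c(2)[OF that(2)] by simp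
  qed
  \<comment> \<open>The truncation by t * c x fixes the realization of L, where c vanishes.\<close>
  have hom1: "homotopic_with ?P (top_of_set ?K) (top_of_set ?K) id r"
  proof (rule homotopic_with_top_of_setI[where h = "\<lambda>u. trunc (fst u * c (snd u), snd u)"])
    show "continuous_on ({0..1} \<times> ?K) (\<lambda>u. trunc (fst u * c (snd u), snd u))"
    proof (rule continuous_on_compose2[OF cont_trunc])
      show "continuous_on ({0..1} \<times> ?K) (\<lambda>u. (fst u * c (snd u), snd u))"
        by (intro continuous_on_Pair continuous_on_mult continuous_on_fst continuous_on_snd
            continuous_on_id continuous_on_compose2[OF cont_c[of UNIV]]) auto
    qed (use scale in auto)
    show "?P f \<longleftrightarrow> ?P g" if "\<And>x. x \<in> ?K \<Longrightarrow> f x = g x" for f g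
      using that by (rule Pext)
    fix t :: real assume t: "t \<in> {0..1}"
    show "trunc (fst (t, x) * c (snd (t, x)), snd (t, x)) \<in> ?K" if "x \<in> ?K" for x
      using trunc_K scale[OF t that] that by simp
    have "trunc (t * c x, x) = x" if "x \<in> ?L" for x
      using \<theta>_L[OF that] trunc_0 that LK eps(1) by (auto simp: c_def)
    then show "?P (\<lambda>x. trunc (fst (t, x) * c (snd (t, x)), snd (t, x)))" by auto
  qed (simp_all add: trunc_0 r_def)
  have cont_r: "continuous_on ?K r"
    using homotopic_with_imp_continuous_maps[OF hom1] by auto
  obtain p where "homotopic_with (\<lambda>f. True) (top_of_set ?L) (top_of_set ?L) id (\<lambda>x. p)"
    using contr by (auto simp: contractible_space_def realization_eq)
  then obtain h where h: "continuous_on ({0..1::real} \<times> ?L) h" "h ` ({0..1} \<times> ?L) \<subseteq> ?L"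
      "\<forall>x. h (0, x) = id x" "\<forall>x. h (1, x) = p"
    unfolding homotopic_with_def by (auto simp: image_subset_iff_funcset)
  have hL: "h (t, y) \<in> ?L" if "t \<in> {0..1}" "y \<in> ?L" for t y
    using h(2) that by blast
  \<comment> \<open>The time for which the contraction is run: 1 on the realization of L, and 0 where theta reaches eps.\<close>
  define s where "s x = max 0 (1 - \<theta> x / \<epsilon>)" for x
  have s: "0 \<le> s x" "s x \<le> 1" if "x \<in> ?K" for x
    using \<theta>_nonneg[OF that] eps(1) by (auto simp: s_def)
  have cont_s: "continuous_on S s" for S
    unfolding s_def[abs_def] using eps(1)
    by (intro continuous_on_max continuous_on_const continuous_on_diff continuous_on_divide cont_\<theta>) auto
  define H where "H = (\<lambda>u. if \<theta> (snd u) \<le> \<epsilon> then h (fst u * s (snd u), r (snd u)) else r (snd u))"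
  define k where "k x = H (1, x)" for x
  have ts: "t * s x \<in> {0..1}" if "t \<in> {0..1}" "x \<in> ?K" for t x
    using that s[OF that(2)] mult_mono[of t 1 "s x" 1] by auto
  have hom2: "homotopic_with ?P (top_of_set ?K) (top_of_set ?K) r k"
  proof (rule homotopic_with_top_of_setI[where h = H])
    show "continuous_on ({0..1} \<times> ?K) H"
      unfolding H_def
    proof (rule continuous_on_cases_le)
      show "continuous_on {u \<in> {0..1} \<times> ?K. \<theta> (snd u) \<le> \<epsilon>} (\<lambda>u. h (fst u * s (snd u), r (snd u)))"
      proof (rule continuous_on_compose2[OF h(1)])
        show "continuous_on {u \<in> {0..1} \<times> ?K. \<theta> (snd u) \<le> \<epsilon>} (\<lambda>u. (fst u * s (snd u), r (snd u)))"
          by (intro continuous_on_Pair continuous_on_mult continuous_on_fst continuous_on_snd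
              continuous_on_id continuous_on_compose2[OF cont_s[of UNIV]] continuous_on_compose2[OF cont_r]) auto
      qed (use ts r_L in auto)
      show "continuous_on {u \<in> {0..1} \<times> ?K. \<epsilon> \<le> \<theta> (snd u)} (\<lambda>u. r (snd u))"
        by (intro continuous_on_compose2[OF cont_r] continuous_on_snd continuous_on_id) auto
      show "continuous_on ({0..1} \<times> ?K) (\<lambda>u. \<theta> (snd u))"
        by (intro continuous_on_compose2[OF cont_\<theta>[of UNIV]] continuous_on_snd continuous_on_id) auto
      show "h (fst u * s (snd u), r (snd u)) = r (snd u)" if "\<theta> (snd u) = \<epsilon>" for u
        using that eps(1) h(3) by (simp add: s_def)
    qed
    show "?P f \<longleftrightarrow> ?P g" if "\<And>x. x \<in> ?K \<Longrightarrow> f x = g x" for f g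
      using that by (rule Pext)
    show "H (0, x) = r x" if "x \<in> ?K" for x
      using h(3) by (simp add: H_def)
    fix t :: real assume t: "t \<in> {0..1}"
    show "H (t, x) \<in> ?K" if "x \<in> ?K" for x
      using hL[OF ts[OF t that] r_L[OF that]] r_K[OF that] LK by (auto simp: H_def)
    show "?P (\<lambda>x. H (t, x))"
    proof (intro image_subsetI)
      fix x assume "x \<in> ?L"
      then have "x \<in> ?K" "\<theta> x \<le> \<epsilon>" using \<theta>_L[of x] LK eps(1) by auto
      then show "H (t, x) \<in> ?L"
        using hL[OF ts[OF t, of x] r_L[of x]] by (simp add: H_def)
    qed
  qed (simp_all add: k_def)
  have "k x = p" if "x \<in> ?L" for x
    using \<theta>_L[OF that] eps(1) h(4) by (simp add: k_def H_def s_def)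
  moreover have "homotopic_with ?P (realization K) (realization K) id k"
    unfolding realization_eq using homotopic_with_trans[OF hom1 hom2] .
  ultimately show ?thesis by blast
qed

section \<open>A simplex modulo its boundary\<close>

definition simplex_depth :: "nat \<Rightarrow> (nat \<Rightarrow> real) \<Rightarrow> real" where
  "simplex_depth d y = Min (y ` {..d})"

definition centre_dist_sq :: "nat \<Rightarrow> (nat \<Rightarrow> real) \<Rightarrow> real" where
  "centre_dist_sq d y = (\<Sum>i=1..d. (y i - 1 / (real d + 1))\<^sup>2)"

text \<open>Let \<open>z\<close> be the position of \<open>y\<close> relative to the barycentre and \<open>\<mu>\<close> its least barycentric coordinate.
  Dividing \<open>z\<close> by \<open>\<mu>\<close> maps the interior of the simplex homeomorphically to the hyperplane of
  vectors with sum \<open>0\<close>, sending the boundary to infinity; omitting the coordinate \<open>0\<close> identifies the hyperplane with a Euclidean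
  space, and the inverse stereographic projection maps this to the sphere without its base point. Clearing denominators
  in the composite gives a formula that is continuous up to the boundary, where \<open>\<mu> = 0\<close>.\<close>

definition simplex_to_sphere :: "nat \<Rightarrow> (nat \<Rightarrow> real) \<Rightarrow> nat \<Rightarrow> real" where
  "simplex_to_sphere d y = (\<lambda>i.
     if i = 0 then (centre_dist_sq d y - (simplex_depth d y)\<^sup>2) / (centre_dist_sq d y + (simplex_depth d y)\<^sup>2)
     else if i \<le> d then 2 * simplex_depth d y * (y i - 1 / (real d + 1)) / (centre_dist_sq d y + (simplex_depth d y)\<^sup>2)
     else 0)"

definition sphere_base :: "nat \<Rightarrow> real" where
  "sphere_base = (\<lambda>j. if j = 0 then 1 else 0)"

lemma simplex_to_sphere_cong:
  assumes "\<And>j. j \<le> d \<Longrightarrow> y j = y' j"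
  shows "simplex_to_sphere d y = simplex_to_sphere d y'"
proof -
  have "y ` {..d} = y' ` {..d}" using assms by (intro image_cong) auto
  then have "simplex_depth d y = simplex_depth d y'" by (simp add: simplex_depth_def)
  moreover have "centre_dist_sq d y = centre_dist_sq d y'"
    unfolding centre_dist_sq_def using assms by (intro sum.cong) auto
  ultimately show ?thesis using assms unfolding simplex_to_sphere_def by (intro ext) simp
qed

locale standard_simplex_point =
  fixes d :: nat and y :: "nat \<Rightarrow> real"
  assumes nonneg: "i \<le> d \<Longrightarrow> 0 \<le> y i" and sum_one: "(\<Sum>i\<le>d. y i) = 1"
begin

abbreviation "\<mu> \<equiv> simplex_depth d y"
abbreviation "n \<equiv> centre_dist_sq d y"
abbreviation "b \<equiv> 1 / (real d + 1)"

lemma split_sum: "(\<Sum>i\<le>d. f i) = f 0 + (\<Sum>i=1..d. f i)" for f :: "nat \<Rightarrow> real"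
  by (simp add: atMost_atLeast0 sum.atLeast_Suc_atMost)

lemma centred_sum: "(\<Sum>i\<le>d. y i - b) = 0"
proof -
  have "(real d + 1) * b = 1" by simp
  then show ?thesis using sum_one by (simp add: sum_subtractf add.commute)
qed

lemma depth_nonneg: "0 \<le> \<mu>"
  using nonneg by (auto simp: simplex_depth_def)

lemma depth_le: "i \<le> d \<Longrightarrow> \<mu> \<le> y i"
  by (simp add: simplex_depth_def)

lemma depth_attained: obtains i where "i \<le> d" "y i = \<mu>"
proof -
  have "\<mu> \<in> y ` {..d}" unfolding simplex_depth_def by (intro Min_in) auto
  then show ?thesis using that by auto
qed

lemma dist_nonneg: "0 \<le> n"
  by (simp add: centre_dist_sq_def sum_nonneg)

text \<open>Both summands vanish only if \<open>y\<close> is the barycentre, whose coordinates are positive, and lies on the boundary.\<close>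

lemma denominator_pos: "0 < n + \<mu>\<^sup>2"
proof (rule ccontr)
  assume "\<not> 0 < n + \<mu>\<^sup>2"
  then have "n = 0" "\<mu>\<^sup>2 = 0" using dist_nonneg zero_le_power2[of \<mu>] by linarith+
  then have z: "n = 0" "\<mu> = 0" by simp_all
  have "\<forall>i\<in>{1..d}. (y i - b)\<^sup>2 = 0"
    using z(1) unfolding centre_dist_sq_def by (subst (asm) sum_nonneg_eq_0_iff) auto
  then have 1: "y i - b = 0" if "i \<in> {1..d}" for i using that by simp
  then have "y 0 - b = 0" using centred_sum by (simp add: split_sum)
  then have "y i = b" if "i \<le> d" for i using 1[of i] that by (cases "i = 0") auto
  moreover obtain i where "i \<le> d" "y i = \<mu>" by (rule depth_attained)
  moreover have "0 < b" by simp
  ultimately show False using z(2) by force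
qed

lemma in_sphere: "simplex_to_sphere d y \<in> topspace (nsphere d)"
proof -
  let ?N = "n + \<mu>\<^sup>2"
  have "(\<Sum>i=1..d. (simplex_to_sphere d y i)\<^sup>2) = (\<Sum>i=1..d. (2 * \<mu> / ?N)\<^sup>2 * (y i - b)\<^sup>2)"
    by (intro sum.cong) (auto simp: simplex_to_sphere_def power_mult_distrib power_divide)
  also have "\<dots> = (2 * \<mu> / ?N)\<^sup>2 * n"
    by (simp add: centre_dist_sq_def sum_distrib_left)
  finally have "(\<Sum>i\<le>d. (simplex_to_sphere d y i)\<^sup>2) = ((n - \<mu>\<^sup>2) / ?N)\<^sup>2 + (2 * \<mu> / ?N)\<^sup>2 * n"
    unfolding split_sum by (simp add: simplex_to_sphere_def)
  also have "\<dots> = ((n - \<mu>\<^sup>2)\<^sup>2 + 4 * \<mu>\<^sup>2 * n) / ?N\<^sup>2"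
    by (simp add: power_divide power_mult_distrib add_divide_distrib)
  also have "(n - \<mu>\<^sup>2)\<^sup>2 + 4 * \<mu>\<^sup>2 * n = ?N\<^sup>2" by (simp add: power2_eq_square algebra_simps)
  also have "?N\<^sup>2 / ?N\<^sup>2 = 1" using denominator_pos by simp
  finally show ?thesis by (simp add: nsphere simplex_to_sphere_def)
qed

lemma one_minus_height: "1 - simplex_to_sphere d y 0 = 2 * \<mu>\<^sup>2 / (n + \<mu>\<^sup>2)"
  using denominator_pos by (simp add: simplex_to_sphere_def field_simps)

lemma to_base_iff: "simplex_to_sphere d y = sphere_base \<longleftrightarrow> \<mu> = 0"
proof
  assume "simplex_to_sphere d y = sphere_base"
  then have "1 - simplex_to_sphere d y 0 = 0" by (simp add: sphere_base_def)
  then show "\<mu> = 0" using denominator_pos unfolding one_minus_height by auto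
next
  assume "\<mu> = 0"
  then show "simplex_to_sphere d y = sphere_base"
    using denominator_pos by (auto simp: simplex_to_sphere_def sphere_base_def)
qed

text \<open>Stereographic projection recovers the quotient of position and depth.\<close>

lemma stereographic:
  assumes "\<mu> \<noteq> 0" "i \<in> {1..d}"
  shows "simplex_to_sphere d y i / (1 - simplex_to_sphere d y 0) = (y i - b) / \<mu>"
proof -
  have "simplex_to_sphere d y i = 2 * \<mu> * (y i - b) / (n + \<mu>\<^sup>2)"
    using assms(2) by (auto simp: simplex_to_sphere_def)
  then show ?thesis
    unfolding one_minus_height using assms(1) denominator_pos by (simp add: power2_eq_square)
qed

end

text \<open>The rescaled positions \<open>w\<close> of \<open>y\<close> and \<open>y'\<close> agree, first for the indices from \<open>1\<close> on and then, as the sum is zero,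
  for all. It remains to see that the depth is determined by \<open>w\<close>: it is the number \<open>\<nu>\<close> for
  which the least coordinate \<open>b + \<nu> * Min w\<close> equals \<open>\<nu>\<close>, where \<open>b\<close> is the coordinate of the barycentre.\<close>

lemma simplex_to_sphere_inj:
  assumes y: "standard_simplex_point d y" and y': "standard_simplex_point d y'"
    and eq: "simplex_to_sphere d y = simplex_to_sphere d y'" and ne: "simplex_to_sphere d y \<noteq> sphere_base"
    and "i \<le> d"
  shows "y i = y' i"
proof -
  interpret y: standard_simplex_point d y by (rule y)
  interpret y': standard_simplex_point d y' by (rule y')
  let ?b = "1 / (real d + 1)"
  have \<mu>: "0 < y.\<mu>" "0 < y'.\<mu>"
    using y.to_base_iff y'.to_base_iff eq ne y.depth_nonneg y'.depth_nonneg by force+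
  have w1: "(y i - ?b) / y.\<mu> = (y' i - ?b) / y'.\<mu>" if "i \<in> {1..d}" for i
    using y.stereographic[OF _ that] y'.stereographic[OF _ that] \<mu> eq by simp
  have "(\<Sum>i\<le>d. (y i - ?b) / y.\<mu>) = 0" "(\<Sum>i\<le>d. (y' i - ?b) / y'.\<mu>) = 0"
    using y.centred_sum y'.centred_sum by (simp_all flip: sum_divide_distrib)
  moreover have "(\<Sum>i=1..d. (y i - ?b) / y.\<mu>) = (\<Sum>i=1..d. (y' i - ?b) / y'.\<mu>)"
    by (intro sum.cong w1) auto
  ultimately have "(y 0 - ?b) / y.\<mu> = (y' 0 - ?b) / y'.\<mu>"
    unfolding y.split_sum by linarith
  then have w: "(y i - ?b) / y.\<mu> = (y' i - ?b) / y'.\<mu>" if "i \<le> d" for i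
    using w1[of i] that by (cases "i = 0") auto
  have le: "\<nu>' \<le> \<nu>" if "0 < \<nu>" "0 < \<nu>'" "(\<nu> - ?b) / \<nu> = (u - ?b) / \<nu>'" "\<nu>' \<le> u" for \<nu> \<nu>' u :: real
  proof -
    have "1 - ?b / \<nu> \<ge> 1 - ?b / \<nu>'"
      using that by (simp add: diff_divide_distrib) 
    then have "?b / \<nu> \<le> ?b / \<nu>'" by linarith
    moreover have "?b / \<nu>' < ?b / \<nu>" if "\<nu> < \<nu>'"
      using that \<open>0 < \<nu>\<close> by (intro divide_strict_left_mono) auto
    ultimately show ?thesis by force
  qed
  have "y'.\<mu> \<le> y.\<mu>"
    by (rule y.depth_attained) (metis le \<mu> w y'.depth_le)
  moreover have "y.\<mu> \<le> y'.\<mu>"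
    by (rule y'.depth_attained) (metis le \<mu> w y.depth_le)
  ultimately show ?thesis using w[OF \<open>i \<le> d\<close>] \<mu> by simp
qed

text \<open>The preimage is found by stereographic projection: \<open>w\<close> is the rescaled position, with the entry \<open>0\<close>
  chosen to make the sum zero, and the depth \<open>\<nu>\<close> solves \<open>b + \<nu> * Min w = \<nu>\<close>.\<close>

lemma simplex_to_sphere_onto:
  assumes s: "s \<in> topspace (nsphere d)" and ne: "s \<noteq> sphere_base"
  obtains y where "standard_simplex_point d y" "\<And>i. i \<le> d \<Longrightarrow> 0 < y i" "simplex_to_sphere d y = s"
proof -
  have s1: "(\<Sum>i\<le>d. (s i)\<^sup>2) = 1" and s0: "\<And>i. d < i \<Longrightarrow> s i = 0"
    using s by (auto simp: nsphere)
  have split: "(\<Sum>i\<le>d. f i) = f 0 + (\<Sum>i=1..d. f i)" for f :: "nat \<Rightarrow> real"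
    by (simp add: atMost_atLeast0 sum.atLeast_Suc_atMost)
  have sq: "(s 0)\<^sup>2 + (\<Sum>i=1..d. (s i)\<^sup>2) = 1" using s1 unfolding split .
  have "s 0 < 1"
  proof (rule ccontr)
    assume "\<not> s 0 < 1"
    then have "1 \<le> (s 0)\<^sup>2" by (simp add: one_le_power)
    moreover have "0 \<le> (\<Sum>i=1..d. (s i)\<^sup>2)" by (simp add: sum_nonneg)
    ultimately have "(s 0)\<^sup>2 = 1" and rest: "(\<Sum>i=1..d. (s i)\<^sup>2) = 0" using sq by linarith+
    then have "s 0 = 1" using \<open>\<not> s 0 < 1\<close> by (auto simp: power2_eq_1_iff)
    moreover have "s i = 0" if "i \<noteq> 0" for i
    proof (cases "i \<le> d")
      case True
      then have "i \<in> {1..d}" using that by auto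
      then have "(s i)\<^sup>2 = 0" using rest by (subst (asm) sum_nonneg_eq_0_iff) auto
      then show ?thesis by simp
    qed (use s0 in simp)
    ultimately show False using ne by (auto simp: sphere_base_def)
  qed
  define a where "a = 1 - s 0"
  have a: "0 < a" using \<open>s 0 < 1\<close> by (simp add: a_def)
  define w where "w i = (if i = 0 then - (\<Sum>i=1..d. s i / a) else s i / a)" for i
  define M where "M = Min (w ` {..d})"
  define \<nu> where "\<nu> = 1 / ((real d + 1) * (1 - M))"
  define y where "y i = 1 / (real d + 1) + \<nu> * w i" for i
  have "(\<Sum>i=1..d. w i) = (\<Sum>i=1..d. s i / a)" by (intro sum.cong) (auto simp: w_def)
  then have wsum: "(\<Sum>i\<le>d. w i) = 0" unfolding split by (simp add: w_def)
  have M_le: "M \<le> w i" if "i \<le> d" for i using that by (simp add: M_def)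
  have "(real d + 1) * M \<le> (\<Sum>i\<le>d. w i)"
    using sum_mono[of "{..d}" "\<lambda>i. M" w] M_le by (simp add: add.commute)
  then have M: "M \<le> 0" using wsum by (simp add: mult_le_0_iff)
  have \<nu>: "0 < \<nu>" using M by (simp add: \<nu>_def)
  have \<nu>_eq: "1 / (real d + 1) + \<nu> * M = \<nu>"
  proof -
    have "1 / (real d + 1) = \<nu> * (1 - M)" using M by (simp add: \<nu>_def)
    then show ?thesis by (simp add: algebra_simps)
  qed
  have y_ge: "\<nu> \<le> y i" if "i \<le> d" for i
  proof -
    have "\<nu> * M \<le> \<nu> * w i" using M_le[OF that] \<nu> by (intro mult_left_mono) auto
    then show ?thesis using \<nu>_eq unfolding y_def by linarith
  qed
  have "(\<Sum>i\<le>d. y i) = 1"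
    by (simp add: y_def sum.distrib wsum flip: sum_distrib_left)
  then have pt: "standard_simplex_point d y"
    using y_ge \<nu> by unfold_locales force+
  have "M \<in> w ` {..d}" unfolding M_def by (intro Min_in) auto
  then obtain i0 where "i0 \<le> d" "w i0 = M" by auto
  then have "y i0 = \<nu>" using \<nu>_eq by (simp add: y_def)
  then have depth: "simplex_depth d y = \<nu>"
    unfolding simplex_depth_def using y_ge \<open>i0 \<le> d\<close> by (intro Min_eqI) auto
  have off: "y i - 1 / (real d + 1) = \<nu> * s i / a" if "i \<in> {1..d}" for i
    using that by (simp add: y_def w_def)
  have "centre_dist_sq d y = (\<Sum>i=1..d. (\<nu> / a)\<^sup>2 * (s i)\<^sup>2)"
    unfolding centre_dist_sq_def
    by (intro sum.cong) (auto simp: off power_mult_distrib power_divide)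
  also have "\<dots> = (\<nu> / a)\<^sup>2 * (1 - (s 0)\<^sup>2)"
    using sq by (simp flip: sum_distrib_left)
  also have "1 - (s 0)\<^sup>2 = a * (1 + s 0)" by (simp add: a_def power2_eq_square algebra_simps)
  also have "(\<nu> / a)\<^sup>2 * (a * (1 + s 0)) = \<nu>\<^sup>2 * (1 + s 0) / a"
    using a by (simp add: power2_eq_square field_simps)
  finally have dist: "centre_dist_sq d y = \<nu>\<^sup>2 * (1 + s 0) / a" .
  have N: "centre_dist_sq d y + \<nu>\<^sup>2 = 2 * \<nu>\<^sup>2 / a"
    using a unfolding dist by (simp add: field_simps) (simp add: a_def algebra_simps)
  have N': "centre_dist_sq d y - \<nu>\<^sup>2 = 2 * \<nu>\<^sup>2 / a * s 0"
    using a unfolding dist by (simp add: field_simps) (simp add: a_def algebra_simps)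
  have "simplex_to_sphere d y = s"
  proof
    fix i
    consider "i = 0" | "i \<in> {1..d}" | "d < i" by force
    then show "simplex_to_sphere d y i = s i"
    proof cases
      case 1
      then show ?thesis unfolding simplex_to_sphere_def depth N N' using a \<nu> by simp
    next
      case 2
      then show ?thesis unfolding simplex_to_sphere_def depth N off[OF 2]
        using a \<nu> by (simp add: power2_eq_square)
    next
      case 3
      then show ?thesis using s0 by (simp add: simplex_to_sphere_def)
    qed
  qed
  then show ?thesis using that[OF pt] y_ge \<nu> by force
qed

lemma continuous_on_simplex_to_sphere:
  fixes f :: "'a::topological_space \<Rightarrow> nat \<Rightarrow> real"
  assumes f: "\<And>i. continuous_on S (\<lambda>x. f x i)" and pt: "\<And>x. x \<in> S \<Longrightarrow> standard_simplex_point d (f x)"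
  shows "continuous_on S (\<lambda>x. simplex_to_sphere d (f x))"
proof (rule continuous_on_coordinatewise_then_product)
  fix i
  have 1: "continuous_on S (\<lambda>x. simplex_depth d (f x))"
    unfolding simplex_depth_def using f by (intro continuous_on_Min_image) auto
  have 2: "continuous_on S (\<lambda>x. centre_dist_sq d (f x))"
    unfolding centre_dist_sq_def
    by (intro continuous_on_sum continuous_on_power continuous_on_diff continuous_on_const f)
  have "centre_dist_sq d (f x) + (simplex_depth d (f x))\<^sup>2 \<noteq> 0" if "x \<in> S" for x
    using standard_simplex_point.denominator_pos[OF pt[OF that]] by simp
  then show "continuous_on S (\<lambda>x. simplex_to_sphere d (f x) i)"
    unfolding simplex_to_sphere_def
    by (cases "i = 0"; cases "i \<le> d")
      (auto intro!: continuous_on_divide continuous_on_mult continuous_on_diff continuous_on_add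
        continuous_on_power continuous_on_const 1 2 f)
qed

section \<open>Homotopy type of shellable complexes\<close>

lemma continuous_map_wedge_inclusion:
  assumes "i \<in> I"
  shows "continuous_map (X i) (wedge X p I) (\<lambda>x. wedge_map p (i, x))"
  unfolding continuous_map_def openin_wedge topspace_wedge using assms by auto

lemma Hausdorff_nsphere: "Hausdorff_space (nsphere d)"
  unfolding nsphere_def by (intro Hausdorff_space_subtopology Hausdorff_Euclidean_space)

text \<open>The map \<open>q\<close> sends \<open>|L|\<close> to the base point and each simplex in \<open>H\<close> to its own sphere. It is continuous because
  \<open>|L|\<close> and these simplices form a finite closed cover, and a quotient map because the wedge carries the final
  topology and each simplex is compact. Its fibres are \<open>|L|\<close> and single points, so the deformation of \<open>|L|\<close> to a point descends.\<close>

theorem contractible_subcomplex_quotient_wedge: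
  assumes K: "finite_complex K" and KLH: "K = L \<union> H" "L \<inter> H = {}" "H \<subseteq> facets K"
    and L: "finite_complex L" "contractible_space (realization L)" "realization_space L \<noteq> {}"
  shows "\<exists>ds. realization K homotopy_equivalent_space sphere_wedge ds"
proof -
  have "finite H" using K KLH(1) by (simp add: finite_complex_def)
  then obtain Hs where Hs: "set Hs = H" "distinct Hs" using finite_distinct_list by blast
  let ?r = "length Hs"
  define ds where "ds = map (\<lambda>F. card F - 1) Hs"
  have face: "Hs ! i \<in> H" "finite (Hs ! i)" "card (Hs ! i) = Suc (ds ! i)" if "i < ?r" for i
  proof -
    show H: "Hs ! i \<in> H" using Hs(1) that nth_mem by blast
    then show fin: "finite (Hs ! i)" using K KLH(1) unfolding finite_complex_def by blast
    have "Hs ! i \<noteq> {}" using H KLH(2) L(1) unfolding finite_complex_def by auto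
    then show "card (Hs ! i) = Suc (ds ! i)"
      using fin that by (simp add: ds_def card_gt_0_iff)
  qed
  have maximal: "G = Hs ! i" if "i < ?r" "G \<in> H" "G \<subseteq> Hs ! i" for i G
    using facets_eqI[of G K "Hs ! i"] face(1)[OF that(1)] that KLH by blast
  have "\<exists>e. bij_betw e {..ds ! i} (Hs ! i)" if "i < ?r" for i
    using face(2,3)[OF that] by (intro finite_same_card_bij) auto
  then obtain e where e: "\<And>i. i < ?r \<Longrightarrow> bij_betw (e i) {..ds ! i} (Hs ! i)" by metis
  define S where "S i = realization_space (Pow (Hs ! i))" for i
  define chart where "chart i x = simplex_to_sphere (ds ! i) (\<lambda>j. x (e i j))" for i x
  have S_iff: "x \<in> S i \<longleftrightarrow> (\<forall>v. 0 \<le> x v) \<and> (\<forall>v. v \<in> Hs ! i \<or> x v = 0) \<and> sum x (Hs ! i) = 1"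
    if "i < ?r" for i x
    using face(2)[OF that] by (simp add: S_def realization_space_Pow)
  have pt: "standard_simplex_point (ds ! i) (\<lambda>j. x (e i j))" if "i < ?r" "x \<in> S i" for i x
    using that sum.reindex_bij_betw[OF e[OF that(1)], of x] by unfold_locales (auto simp: S_iff)
  have boundary: "chart i x = sphere_base \<longleftrightarrow> support x \<noteq> Hs ! i" if i: "i < ?r" and x: "x \<in> S i" for i x
  proof -
    interpret standard_simplex_point "ds ! i" "\<lambda>j. x (e i j)" by (rule pt[OF i x])
    have im: "e i ` {..ds ! i} = Hs ! i" using e[OF i] by (simp add: bij_betw_def)
    have "\<mu> = 0 \<longleftrightarrow> (\<exists>j\<le>ds ! i. x (e i j) = 0)"
      by (metis depth_attained depth_le depth_nonneg order_antisym)
    also have "\<dots> \<longleftrightarrow> (\<exists>v\<in>Hs ! i. x v = 0)" unfolding im[symmetric] by auto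
    also have "\<dots> \<longleftrightarrow> support x \<noteq> Hs ! i" using x by (auto simp: S_iff[OF i] support_def)
    finally show ?thesis unfolding chart_def to_base_iff .
  qed
  let ?wm = "wedge_map (\<lambda>i. sphere_base)"
  have W: "sphere_wedge ds = wedge (\<lambda>i. nsphere (ds ! i)) (\<lambda>i. sphere_base) {..<?r}"
    by (simp add: sphere_wedge_def sphere_base_def ds_def)
  have topW: "topspace (sphere_wedge ds) = insert None (?wm ` Sigma {..<?r} (topspace \<circ> (\<lambda>i. nsphere (ds ! i))))"
    unfolding W by (rule topspace_wedge)
  \<comment> \<open>The index of the facet support x is unique, as Hs has no repetitions.\<close>
  define q where "q x = (if support x \<in> H then
      (let i = (SOME i. i < ?r \<and> Hs ! i = support x) in ?wm (i, chart i x)) else None)" for x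
  have q_S: "q x = ?wm (i, chart i x)" if i: "i < ?r" and x: "x \<in> S i" for i x
  proof (cases "support x = Hs ! i")
    case True
    have "(SOME j. j < ?r \<and> Hs ! j = support x) = i"
      using i True Hs(2) nth_eq_iff_index_eq by (intro some_equality) fastforce+
    then show ?thesis using True face(1)[OF i] by (simp add: q_def)
  next
    case False
    have "support x \<subseteq> Hs ! i" using x by (auto simp: S_def realization_space_def)
    then have "support x \<notin> H" using False maximal[OF i] by blast
    then show ?thesis using boundary[OF i x] False by (simp add: q_def wedge_map_def)
  qed
  have q_L: "q x = None" if "x \<in> realization_space L" for x
  proof -
    have "support x \<notin> H" using that KLH(2) by (auto simp: realization_space_def)
    then show ?thesis by (simp add: q_def)
  qed
  have cases: "x \<in> realization_space L \<or> (\<exists>i<?r. x \<in> S i \<and> support x = Hs ! i)"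
    if "x \<in> realization_space K" for x
  proof (cases "support x \<in> L")
    case False
    then have "support x \<in> set Hs" using that KLH(1) Hs(1) by (auto simp: realization_space_def)
    then obtain i where "i < ?r" "Hs ! i = support x" by (auto simp: in_set_conv_nth)
    then show ?thesis using that by (auto simp: S_def realization_space_def)
  qed (use that in \<open>auto simp: realization_space_def\<close>)
  have chart_in: "chart i x \<in> topspace (nsphere (ds ! i))" if "i < ?r" "x \<in> S i" for i x
    unfolding chart_def by (rule standard_simplex_point.in_sphere[OF pt[OF that]])
  have cont_chart: "continuous_map (top_of_set (S i)) (nsphere (ds ! i)) (chart i)" if i: "i < ?r" for i
  proof -
    have "continuous_on (S i) (chart i)"
      unfolding chart_def[abs_def]
      using pt[OF i] by (intro continuous_on_simplex_to_sphere continuous_on_coordinate) auto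
    moreover have "chart i \<in> S i \<rightarrow> topspace (nsphere (ds ! i))" using chart_in[OF i] by blast
    ultimately show ?thesis
      by (simp add: nsphere euclidean_product_topology)
  qed
  have SK: "S i \<subseteq> realization_space K" if "i < ?r" for i
    using face(1)[OF that] KLH(1) K unfolding S_def finite_complex_def
    by (intro realization_space_mono) blast
  have LK: "realization_space L \<subseteq> realization_space K"
    using KLH(1) by (intro realization_space_mono) blast
  have compact_S: "compact (S i)" if "i < ?r" for i
    unfolding S_def using face(2)[OF that] by (rule compact_simplex)
  have closed_S: "closed (S i)" if "i < ?r" for i
    unfolding S_def using face(2)[OF that] by (rule closed_simplex)
  have cont_q: "continuous_map (realization K) (sphere_wedge ds) q"
  proof (rule pasting_lemma_closed[where I = "insert None (Some ` {..<?r})"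
        and T = "\<lambda>u. case u of None \<Rightarrow> realization_space L | Some i \<Rightarrow> S i" and f = "\<lambda>u. q"])
    fix u assume u: "u \<in> insert None (Some ` {..<?r})"
    show "closedin (realization K) (case u of None \<Rightarrow> realization_space L | Some i \<Rightarrow> S i)"
      using u LK SK closed_S closed_realization_space[OF L(1)]
      by (cases u) (simp_all add: realization_eq closed_subset image_iff)
    show "continuous_map (subtopology (realization K) (case u of None \<Rightarrow> realization_space L | Some i \<Rightarrow> S i))
        (sphere_wedge ds) q"
    proof (cases u)
      case None
      have "continuous_map (top_of_set (realization_space L)) (sphere_wedge ds) (\<lambda>x. None)"
        by (simp add: topW)
      then have "continuous_map (top_of_set (realization_space L)) (sphere_wedge ds) q"
        by (rule continuous_map_eq) (simp add: q_L)
      then show ?thesis using None LK by (simp add: realization_eq subtopology_subtopology inf_absorb2)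
    next
      case (Some i)
      then have i: "i < ?r" using u by auto
      have "continuous_map (top_of_set (S i)) (sphere_wedge ds) ((\<lambda>s. ?wm (i, s)) \<circ> chart i)"
        unfolding W using i by (intro continuous_map_compose[OF cont_chart] continuous_map_wedge_inclusion) auto
      then have "continuous_map (top_of_set (S i)) (sphere_wedge ds) q"
        by (rule continuous_map_eq) (simp add: q_S[OF i])
      then show ?thesis using Some SK[OF i] by (simp add: realization_eq subtopology_subtopology inf_absorb2)
    qed
  next
    fix x assume "x \<in> topspace (realization K)"
    then have "x \<in> realization_space K" by (simp add: realization_eq)
    then consider "x \<in> realization_space L" | i where "i < ?r" "x \<in> S i" using cases by blast
    then show "\<exists>u. u \<in> insert None (Some ` {..<?r}) \<and>
        x \<in> (case u of None \<Rightarrow> realization_space L | Some i \<Rightarrow> S i) \<and> q x = q x"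
    proof cases
      case 1
      then show ?thesis by (intro exI[of _ None]) simp
    next
      case 2
      then show ?thesis by (intro exI[of _ "Some i"]) simp
    qed
  qed auto
  obtain x0 where x0: "x0 \<in> realization_space L"
    using L(3) by blast
  have reach: "\<exists>x\<in>S i. chart i x = s \<and> support x = Hs ! i"
    if i: "i < ?r" and s: "s \<in> topspace (nsphere (ds ! i))" "s \<noteq> sphere_base" for i s
  proof -
    obtain y where y: "standard_simplex_point (ds ! i) y" "\<And>j. j \<le> ds ! i \<Longrightarrow> 0 < y j"
        "simplex_to_sphere (ds ! i) y = s"
      using simplex_to_sphere_onto[OF s] by metis
    define x where "x v = (if v \<in> Hs ! i then y (inv_into {..ds ! i} (e i) v) else 0)" for v
    have inv: "inv_into {..ds ! i} (e i) (e i j) = j" "e i j \<in> Hs ! i" if "j \<le> ds ! i" for j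
      using e[OF i] that by (auto simp: bij_betw_def inv_into_f_f)
    have xe: "x (e i j) = y j" if "j \<le> ds ! i" for j using inv[OF that] by (simp add: x_def)
    have pre: "inv_into {..ds ! i} (e i) v \<le> ds ! i" if "v \<in> Hs ! i" for v
      using e[OF i] that inv_into_into[of v "e i" "{..ds ! i}"] by (auto simp: bij_betw_def)
    have "sum x (Hs ! i) = (\<Sum>j\<le>ds ! i. x (e i j))"
      using sum.reindex_bij_betw[OF e[OF i], of x] by simp
    also have "\<dots> = 1" using standard_simplex_point.sum_one[OF y(1)] by (simp add: xe)
    finally have "x \<in> S i"
      using y(2) pre by (auto simp: S_iff[OF i] x_def less_imp_le)
    moreover have "support x = Hs ! i"
      using y(2)[OF pre] by (force simp: support_def x_def)
    moreover have "chart i x = s"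
      unfolding chart_def y(3)[symmetric]
      by (rule simplex_to_sphere_cong) (simp add: xe)
    ultimately show ?thesis by blast
  qed
  have onto: "q ` realization_space K = topspace (sphere_wedge ds)"
  proof
    show "q ` realization_space K \<subseteq> topspace (sphere_wedge ds)"
      using continuous_map_image_subset_topspace[OF cont_q] by (simp add: realization_eq)
    show "topspace (sphere_wedge ds) \<subseteq> q ` realization_space K"
    proof
      fix w assume "w \<in> topspace (sphere_wedge ds)"
      then consider "w = None" | i s where "i < ?r" "s \<in> topspace (nsphere (ds ! i))" "w = ?wm (i, s)"
        unfolding topW by auto
      then consider "w = None" | i s where "i < ?r" "s \<in> topspace (nsphere (ds ! i))" "s \<noteq> sphere_base" "w = ?wm (i, s)"
        by (metis (mono_tags, lifting) case_prod_conv wedge_map_def)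
      then show "w \<in> q ` realization_space K"
      proof cases
        case 1
        then show ?thesis using q_L[OF x0] x0 LK by (auto intro: image_eqI[of _ _ x0])
      next
        case 2
        then obtain x where "x \<in> S i" "chart i x = s" using reach by blast
        then show ?thesis using 2 q_S SK by (intro image_eqI[of _ _ x]) auto
      qed
    qed
  qed
  have quot: "quotient_map (realization K) (sphere_wedge ds) q"
    unfolding quotient_map_def
  proof (intro conjI allI impI)
    show "q ` topspace (realization K) = topspace (sphere_wedge ds)"
      using onto by (simp add: realization_eq)
    fix U assume U: "U \<subseteq> topspace (sphere_wedge ds)"
    show "openin (realization K) {x \<in> topspace (realization K). q x \<in> U} = openin (sphere_wedge ds) U"
    proof
      assume "openin (sphere_wedge ds) U"
      then show "openin (realization K) {x \<in> topspace (realization K). q x \<in> U}"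
        using cont_q by (rule openin_continuous_map_preimage[rotated])
    next
      assume op: "openin (realization K) {x \<in> topspace (realization K). q x \<in> U}"
      have "openin (nsphere (ds ! i)) {s \<in> topspace (nsphere (ds ! i)). ?wm (i, s) \<in> U}"
        if i: "i < ?r" for i
      proof -
        let ?Y = "nsphere (ds ! i)"
        let ?C = "{s \<in> topspace ?Y. ?wm (i, s) \<notin> U}"
        \<comment> \<open>The base point is treated separately: a vertex in H has empty boundary, and then no point of the
          simplex is mapped to the base point of the 0-sphere.\<close>
        let ?B = "if None \<in> U then {} else {sphere_base}"
        let ?T = "{x \<in> S i. q x \<notin> U}"
        obtain Q where Q: "open Q" "{x \<in> realization_space K. q x \<in> U} = realization_space K \<inter> Q"
          using op by (auto simp: realization_eq openin_open)
        have "S i \<inter> {x \<in> realization_space K. q x \<in> U} = S i \<inter> Q"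
          unfolding Q(2) using SK[OF i] by auto
        then have "openin (top_of_set (S i)) (S i \<inter> {x \<in> realization_space K. q x \<in> U})"
          using Q(1) by (simp add: openin_open_Int)
        moreover have "?T = S i - (S i \<inter> {x \<in> realization_space K. q x \<in> U})"
          using SK[OF i] by auto
        ultimately have "closedin (top_of_set (S i)) ?T"
          by (simp add: closedin_def Diff_Diff_Int)
        moreover have "closed_map (top_of_set (S i)) ?Y (chart i)"
          using cont_chart[OF i] compact_S[OF i] Hausdorff_nsphere
          by (intro continuous_imp_closed_map) (auto simp: compact_space_subtopology)
        ultimately have C_T: "closedin ?Y (chart i ` ?T)" by (simp add: closed_map_def)
        have C_B: "closedin ?Y ?B"
          using sphere_basepoint[of "ds ! i"] Hausdorff_imp_t1_space[OF Hausdorff_nsphere]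
          by (auto simp: sphere_base_def t1_space_closedin_singleton)
        have C_eq: "?C = chart i ` ?T \<union> ?B"
        proof (intro equalityI subsetI)
          fix s assume s: "s \<in> ?C"
          show "s \<in> chart i ` ?T \<union> ?B"
          proof (cases "s = sphere_base")
            case True
            then show ?thesis using s by (auto simp: wedge_map_def)
          next
            case False
            then obtain x where "x \<in> S i" "chart i x = s" using reach[OF i] s by blast
            then show ?thesis using s q_S[OF i] by (intro UnI1 image_eqI[of _ _ x]) auto
          qed
        next
          fix s assume "s \<in> chart i ` ?T \<union> ?B"
          then show "s \<in> ?C"
            using chart_in[OF i] q_S[OF i] sphere_basepoint[of "ds ! i"]
            by (auto simp: wedge_map_def sphere_base_def[symmetric] split: if_splits)
        qed
        have "closedin ?Y ?C" by (subst C_eq) (rule closedin_Un[OF C_T C_B])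
        then have "openin ?Y (topspace ?Y - ?C)" by (rule openin_diff[OF openin_topspace])
        moreover have "{s \<in> topspace ?Y. ?wm (i, s) \<in> U} = topspace ?Y - ?C" by auto
        ultimately show ?thesis by (simp only:)
      qed
      then show "openin (sphere_wedge ds) U"
        using U unfolding W openin_wedge topspace_wedge by auto
    qed
  qed
  have fibre: "x = y \<or> (x \<in> realization_space L \<and> y \<in> realization_space L)"
    if xy: "x \<in> realization_space K" "y \<in> realization_space K" "q x = q y" for x y
  proof -
    have some: "\<exists>i s. q u = Some (i, s)" if "i < ?r" "u \<in> S i" "support u = Hs ! i" for i u
      using q_S[OF that(1,2)] boundary[OF that(1,2)] that(3) by (simp add: wedge_map_def)
    show ?thesis
    proof (cases "q x = None")
      case True
      then show ?thesis using cases xy some by (metis option.distinct(1))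
    next
      case False
      then obtain i where i: "i < ?r" "x \<in> S i" "support x = Hs ! i"
        using cases[OF xy(1)] q_L[of x] by auto
      obtain j where j: "j < ?r" "y \<in> S j" "support y = Hs ! j"
        using cases[OF xy(2)] q_L[of y] xy(3) False by auto
      have ne: "chart i x \<noteq> sphere_base" "chart j y \<noteq> sphere_base"
        using boundary[OF i(1,2)] boundary[OF j(1,2)] i(3) j(3) by simp_all
      then have ij: "i = j" "chart i x = chart j y"
        using q_S[OF i(1,2)] q_S[OF j(1,2)] xy(3) by (auto simp: wedge_map_def)
      have "x v = y v" for v
      proof (cases "v \<in> Hs ! i")
        case True
        then obtain k where "k \<le> ds ! i" "v = e i k" using e[OF i(1)] by (auto simp: bij_betw_def)
        then show ?thesis
          using simplex_to_sphere_inj[OF pt[OF i(1,2)] pt[OF i(1), of y]] j ij ne(1) by (simp add: chart_def)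
      next
        case False
        then have "v \<notin> support x" "v \<notin> support y" using i(3) j(3) ij(1) by simp_all
        then show ?thesis by (simp add: support_def)
      qed
      then show ?thesis by auto
    qed
  qed
  obtain k p where k: "homotopic_with (\<lambda>f. f ` realization_space L \<subseteq> realization_space L)
        (realization K) (realization K) id k" "\<forall>x\<in>realization_space L. k x = p"
    using deform_subcomplex_to_point[OF K _ L(1,2)] KLH(1) by blast
  have "realization K homotopy_equivalent_space sphere_wedge ds"
  proof (rule quotient_homotopy_equivalence[OF quot])
    show "homotopic_with (\<lambda>f. \<forall>x\<in>topspace (realization K). \<forall>y\<in>topspace (realization K).
        q x = q y \<longrightarrow> q (f x) = q (f y)) (realization K) (realization K) id k"
    proof (rule homotopic_with_mono[OF k(1)])
      fix f assume f: "f ` realization_space L \<subseteq> realization_space L"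
      have "q (f x) = q (f y)" if "x \<in> realization_space K" "y \<in> realization_space K" "q x = q y" for x y
        using fibre[OF that] q_L f by (metis image_subset_iff)
      then show "\<forall>x\<in>topspace (realization K). \<forall>y\<in>topspace (realization K). q x = q y \<longrightarrow> q (f x) = q (f y)"
        unfolding realization_eq topspace_euclidean_subtopology by blast
    qed
    fix x y assume "x \<in> topspace (realization K)" "y \<in> topspace (realization K)" "q x = q y"
    then show "k x = k y" using fibre[of x y] k(2)
      unfolding realization_eq topspace_euclidean_subtopology by metis
  qed
  then show ?thesis by blast
qed

text \<open>If \<open>L\<close> is void, the empty face belongs to \<open>H\<close> and is a facet, so that \<open>K\<close> is the sphere of dimension \<open>-1\<close>.\<close>

theorem shellable_homotopy_wedge_of_spheres:
  assumes "shellable K"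
  shows "homotopy_wedge_of_spheres K"
proof -
  have K: "finite_complex K" using assms by (simp add: shellable_def)
  obtain L H where LH: "K = L \<union> H" "L \<inter> H = {}" "H \<subseteq> facets K" "interval_collapsible L"
    using shellable_decomposition[OF assms] by blast
  show ?thesis
  proof (cases "L = {}")
    case True
    then have "{} \<in> facets K" using LH K by (auto simp: finite_complex_def)
    then have "K = {{}}" by (auto simp: facets_def)
    then show ?thesis by (simp add: homotopy_wedge_of_spheres_def)
  next
    case False
    obtain v where "{v} \<in> L" using interval_collapsible_vertex[OF LH(4) False] .
    then have "realization_space L \<noteq> {}" using realization_space_vertex[of v L] by auto
    then have "\<exists>ds. realization K homotopy_equivalent_space sphere_wedge ds"
      using interval_collapsible_contractible[OF LH(4) False]
      by (intro contractible_subcomplex_quotient_wedge[OF K LH(1-3)]) simp_all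
    then show ?thesis by (simp add: homotopy_wedge_of_spheres_def)
  qed
qed

section \<open>The order complex of proper divisibility\<close>

text \<open>The componentwise greatest vector that properly divides \<open>x\<close>.\<close>

definition pred_vector :: "nat list \<Rightarrow> nat list" where
  "pred_vector x = map (\<lambda>k. k - 1) x"

theorem shellable_pd_poset: "shellable (order_complex pd_le (pd_poset a))"
proof -
  let ?P = "{x :: nat list. \<exists>i<length x. 0 < x ! i}"
  interpret finitary_poset pd_le ?P
  proof
    show "pd_le x x" "pd_le x y \<Longrightarrow> pd_le y x \<Longrightarrow> x = y" "pd_le x y \<Longrightarrow> pd_le y z \<Longrightarrow> pd_le x z" for x y z
      using pd_le_refl pd_le_antisym pd_le_trans by blast+
    show "finite (strictly_below pd_le ?P x)" for x
      by (rule finite_subset[OF _ finite_pd_poset[of x]]) (auto simp: strictly_below_def pd_poset_def)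
  qed
  have below: "y \<in> below x \<longleftrightarrow> properly_divides y x \<and> (\<exists>i<length y. 0 < y ! i)" for x y
  proof -
    have "x \<noteq> y" if "properly_divides y x" "\<exists>i<length y. 0 < y ! i"
      using that by (auto simp: properly_divides_nth)
    then show ?thesis
      by (auto simp: strictly_below_def pd_le_def)
  qed
  have mem: "pred_vector x \<in> below x" if ne: "below x \<noteq> {}" for x
  proof -
    obtain y i where y: "properly_divides y x" "i < length y" "0 < y ! i" using ne below by blast
    then have "i < length x" "1 < x ! i" by (auto simp: properly_divides_nth)
    then show ?thesis
      unfolding below by (auto simp: properly_divides_nth pred_vector_def)
  qed
  \<comment> \<open>A positive entry of z increases strictly in both steps z < y < x,
    so it is less than the corresponding entry of x minus one.\<close>
  have dom: "below y \<subseteq> below (pred_vector x)" if y: "y \<in> below x" for x y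
  proof
    fix z assume z: "z \<in> below y"
    have len: "length y = length x" "length z = length x"
      using y z by (auto simp: below properly_divides_nth)
    have "(z ! i = 0 \<and> x ! i - 1 = 0) \<or> z ! i < x ! i - 1" if "i < length x" for i
    proof -
      have "(z ! i = 0 \<and> y ! i = 0) \<or> z ! i < y ! i" "(y ! i = 0 \<and> x ! i = 0) \<or> y ! i < x ! i"
        using y z that len unfolding below properly_divides_nth by auto
      then show ?thesis by linarith
    qed
    then have "properly_divides z (pred_vector x)"
      using len by (simp add: properly_divides_nth pred_vector_def)
    then show "z \<in> below (pred_vector x)"
      using z by (simp add: below)
  qed
  have "x = replicate (length a) 0 \<longleftrightarrow> x \<notin> ?P" if "x \<in> pd_poset a" for x
    using length_pd_poset[OF that] by (simp add: list_eq_iff_nth_eq)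
  then have "proper_part pd_le (pd_poset a) = {x \<in> pd_poset a. x \<in> ?P \<and> x \<noteq> a}"
    unfolding proper_part_pd_poset by blast
  then have "proper_part pd_le (pd_poset a) = below a"
    unfolding strictly_below_def pd_poset_def by blast
  then have "order_complex pd_le (pd_poset a) = chains_of pd_le (below a)"
    by (simp add: order_complex_def chains_of_def)
  then show ?thesis
    using shelling_below[of pred_vector a, OF mem dom]
      finite_complex_order_complex[OF finite_pd_poset, of pd_le a]
    by (simp add: shellable_iff)
qed

theorem theorem1p1:
  fixes n :: nat and a :: "nat list"
  assumes "n \<ge> 1" and "length a = n"
  shows "shellable (order_complex pd_le (pd_poset a)) \<and>
    homotopy_wedge_of_spheres (order_complex pd_le (pd_poset a)) \<and>
    (\<forall>k. torsion_free_group (reduced_simplicial_homology (order_complex pd_le (pd_poset a)) k))"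
  by (intro conjI allI shellable_pd_poset shellable_homotopy_wedge_of_spheres
      shellable_torsion_free_homology)

end
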